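(* Under the standing setup in the context, assume that for every $k\ge\bar\kappa$: (C1) $\eta_k(\mu+L)+\gamma_k\rho_N\le 2$; (C2) $\dfrac{\eta_k}{\gamma_k}\le \dfrac{\zeta\,\mu\rho_2}{\sqrt N\,\nabla^* L}$; (C3) $\dfrac{\gamma_k}{\eta_k}\le\dfrac{\gamma_{k+1}}{\eta_{k+1}}$. Then for every $k\ge\bar\kappa$: $$\frac{1}{\sqrt N}\|\mathbf W_k-\overline{\mathbf W}_k\|_{\mathbb E}\le\Big[\sum_{t=\bar\kappa}^{k-1}P_{tk}^2\big(\gamma_t^2\Sigma^{(1)}+\eta_t^2\Sigma^{(2)}\big)\Big]^{1/2},$$ $$\frac{1}{\sqrt N}\|\overline{\mathbf W}_k-\mathbf W_k^*\|_{\mathbb E}\le \mathrm{dm}(\mathcal W)\,P_{(\bar\kappa-1)k}+\frac{\nabla^*L}{\mu\rho_2}\sum_{t=\bar\kappa}^{k-1}P_{tk}\Big(1+\frac{L^2}{\mu\rho_2}\frac{\eta_t}{\gamma_t}\Big)\Big(\frac{\eta_t}{\gamma_t}-\frac{\eta_{t+1}}{\gamma_{t+1}}\Big),$$ $$\frac{1}{\sqrt N}\|\mathbf W_k^*-\mathbf W^*\|\le\frac{\nabla^*L}{\mu\rho_2}\,\frac{\eta_k}{\gamma_k},$$ where $P_{tk}\triangleq\prod_{j=t+1}^{k-1}(1-\mu\eta_j)$ for $t\le k-1$ (empty product $=1$).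
   Context: Standing setup. Let $N\ge2$, $d\ge1$. For $i=1,\dots,N$, $f_i:\mathbb R^d\to\mathbb R$ is $\mu$-strongly convex and $L$-smooth (gradient $L$-Lipschitz), $0<\mu\le L$. Let $F(\mathbf w)=\frac1N\sum_i f_i(\mathbf w)$ with unique minimizer $\mathbf w^*\in\mathbb R^d$. Let $\mathcal W\subset\mathbb R^d$ be nonempty, closed, convex, bounded with $\mathbf w^*\in\mathrm{int}(\mathcal W)$; $\zeta\triangleq\min_{\mathbf w\in\mathrm{bd}(\mathcal W)}\|\mathbf w-\mathbf w^*\|>0$; $\mathrm{dm}(\mathcal W)\triangleq\max_{\mathbf w,\mathbf w'\in\mathcal W}\|\mathbf w-\mathbf w'\|$; $\nabla^*\triangleq\max_i\|\nabla f_i(\mathbf w^* )\|$. Let $\mathbf L\in\mathbb R^{N\times N}$ be a Laplacian matrix: symmetric, off-diagonal entries $\le0$, $\mathbf L\mathbf 1_N=\mathbf 0$; its eigenvalues are $0=\rho_1\le\rho_2\le\dots\le\rho_N$, and $\rho_2>0$. Set $\hat{\mathbf L}=\mathbf L\otimes\mathbf I_d$. For $\mathbf W=[\mathbf w_1^\top,\dots,\mathbf w_N^\top]^\top\in\mathbb R^{Nd}$ let $f(\mathbf W)=\sum_i f_i(\mathbf w_i)$, and $\mathbf W^*=\mathbf 1_N\otimes\mathbf w^*$. $\Pi^N$ denotes Euclidean projection onto $\mathcal W^N$. Given stepsizes $\eta_k,\gamma_k>0$, define $G_k(\mathbf W)=f(\mathbf W)+\frac{\gamma_k}{2\eta_k}\mathbf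 W^\top\hat{\mathbf L}\mathbf W$ and $\mathbf W_k^*=\arg\min_{\mathbf W\in\mathcal W^N}G_k(\mathbf W)$. On a probability space with filtration $(\mathcal F_k)$, fix an integer $\bar\kappa\ge0$ and an $\mathcal F_{\bar\kappa}$-measurable $\mathbf W_{\bar\kappa}\in\mathcal W^N$, and define for $k\ge\bar\kappa$ $$\mathbf W_{k+1}=\Pi^N\big[\mathbf W_k-\eta_k\nabla G_k(\mathbf W_k)+\gamma_k\boldsymbol\epsilon_k^{(1)}-\eta_k\boldsymbol\epsilon_k^{(2)}\big],$$ where $\boldsymbol\epsilon_k^{(1)},\boldsymbol\epsilon_k^{(2)}\in\mathbb R^{Nd}$ are $\mathcal F_{k+1}$-measurable with $\mathbb E[\boldsymbol\epsilon_k^{(1)}|\mathcal F_k]=\mathbb E[\boldsymbol\epsilon_k^{(2)}|\mathcal F_k]=\mathbf 0$, $\mathbb E[\langle\boldsymbol\epsilon_k^{(1)},\boldsymbol\epsilon_k^{(2)}\rangle|\mathcal F_k]=0$, and $\frac1N\mathbb E[\|\boldsymbol\epsilon_k^{(1)}\|^2|\mathcal F_k]\le\Sigma^{(1)}$, $\frac1N\mathbb E[\|\boldsymbol\epsilon_k^{(2)}\|^2|\mathcal F_k]\le\Sigma^{(2)}$ for constants $\Sigma^{(1)},\Sigma^{(2)}\ge0$. The noise-free dynamics are $\overline{\mathbf W}_{\bar\kappa}=\mathbf W_{\bar\kappa}$, $\overline{\mathbf W}_{k+1}=\Pi^N[\overline{\mathbf W}_k-\eta_k\nabla G_k(\overline{\mathbf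 W}_k)]$ for $k\ge\bar\kappa$. For a random vector $\mathbf a$, $\|\mathbf a\|_{\mathbb E}\triangleq\sqrt{\mathbb E\|\mathbf a\|^2}$. *)

theory Defs
  imports "HOL-Probability.Probability" "HOL-Computational_Algebra.Polynomial"
begin

definition grad :: "('a::real_inner \<Rightarrow> real) \<Rightarrow> 'a \<Rightarrow> 'a" where
  "grad g x = (THE D. GDERIV g x :> D)"

definition charpoly :: "real^'n^'n \<Rightarrow> real poly" where
  "charpoly A = det (\<chi> i j. [: - (A$i$j), (if i = j then 1 else 0) :])"

definition eigs :: "real^'n^'n \<Rightarrow> real list" where
  "eigs A = sorted_list_of_multiset (proots (charpoly A))"

definition rho :: "real^'n^'n \<Rightarrow> nat \<Rightarrow> real" where
  "rho A j = eigs A ! (j - 1)"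

definition stackset :: "('a::real_normed_vector) set \<Rightarrow> ('a^'n) set" where
  "stackset S = {V. \<forall>i. V$i \<in> S}"

definition projN :: "(real^'d) set \<Rightarrow> real^'d^'n \<Rightarrow> real^'d^'n" where
  "projN S V = closest_point (stackset S) V"

text \<open>Quadratic form W^T (L \<otimes> I_d) W.\<close>
definition lapquad :: "real^'n^'n \<Rightarrow> real^'d^'n \<Rightarrow> real" where
  "lapquad L V = (\<Sum>i\<in>UNIV. \<Sum>j\<in>UNIV. L$i$j * (V$i \<bullet> V$j))"

text \<open>G_k(W) = f(W) + c/2 W^T Lhat W, with c = gamma_k / eta_k.\<close>
definition Gfun :: "('n \<Rightarrow> real^'d \<Rightarrow> real) \<Rightarrow> real^'n^'n \<Rightarrow> real \<Rightarrow> real^'d^'n \<Rightarrow> real" where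
  "Gfun f L c V = (\<Sum>i\<in>UNIV. f i (V$i)) + c / 2 * lapquad L V"

definition Gmin :: "(real^'d) set \<Rightarrow> ('n \<Rightarrow> real^'d \<Rightarrow> real) \<Rightarrow> real^'n^'n \<Rightarrow> real \<Rightarrow> real^'d^'n" where
  "Gmin S f L c = (SOME V. V \<in> stackset S \<and> (\<forall>U\<in>stackset S. Gfun f L c V \<le> Gfun f L c U))"

text \<open>The iteration started at time kb: dsgd ... n is W_{kb+n}.\<close>
primrec dsgd :: "(real^'d) set \<Rightarrow> ('n \<Rightarrow> real^'d \<Rightarrow> real) \<Rightarrow> real^'n^'n \<Rightarrow> (nat \<Rightarrow> real) \<Rightarrow> (nat \<Rightarrow> real)
   \<Rightarrow> (nat \<Rightarrow> 'w \<Rightarrow> real^'d^'n) \<Rightarrow> (nat \<Rightarrow> 'w \<Rightarrow> real^'d^'n) \<Rightarrow> nat \<Rightarrow> ('w \<Rightarrow> real^'d^'n)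
   \<Rightarrow> nat \<Rightarrow> 'w \<Rightarrow> real^'d^'n" where
  "dsgd S f L eta gam e1 e2 kb W0 0 \<omega> = W0 \<omega>"
| "dsgd S f L eta gam e1 e2 kb W0 (Suc n) \<omega> =
     projN S (dsgd S f L eta gam e1 e2 kb W0 n \<omega>
       - eta (kb + n) *\<^sub>R grad (Gfun f L (gam (kb + n) / eta (kb + n))) (dsgd S f L eta gam e1 e2 kb W0 n \<omega>)
       + gam (kb + n) *\<^sub>R e1 (kb + n) \<omega> - eta (kb + n) *\<^sub>R e2 (kb + n) \<omega>)"

text \<open>P_{tk} = prod_{j=t+1}^{k-1} (1 - mu eta_j) is Pprod mu eta (t+1) k.\<close>
definition Pprod :: "real \<Rightarrow> (nat \<Rightarrow> real) \<Rightarrow> nat \<Rightarrow> nat \<Rightarrow> real" where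
  "Pprod mu eta a k = (\<Prod>j\<in>{a..<k}. 1 - mu * eta j)"

definition enorm :: "'w measure \<Rightarrow> ('w \<Rightarrow> 'v::real_normed_vector) \<Rightarrow> real" where
  "enorm M X = sqrt (LINT \<omega>|M. (norm (X \<omega>))\<^sup>2)"

end

theory Submission
  imports Defs
begin

text \<open>
  Put \<open>h = \<nabla>f(X) - \<nabla>f(Y)\<close> on the stacked space. By Baillon--Haddad both \<open>h - mu (X - Y)\<close> and the Laplacian
  term are cocoercive, so (C1) makes the gradient step of \<open>G\<^sub>k\<close> a contraction with factor \<open>1 - mu eta\<^sub>k\<close>;
  this gives the noise bound (the noise is conditionally centered, hence orthogonal to the contracted difference)
  and the tracking bound up to the drift of the minimizers. By Banach's theorem \<open>G\<^sub>k\<close> has an unconstrained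
  critical point, which by (C2) lies in the constraint set and hence is the constrained minimizer. Its distance
  to consensus and its drift follow from one perturbation estimate: if \<open>s h + Lhat (X - Y) = b\<close> and \<open>h\<close> sums to
  zero over the nodes, then \<open>|X - Y| \<le> L / (mu rho\<^sub>2) |b|\<close>.
\<close>

section \<open>Symmetric matrices and Laplacians\<close>

text \<open>The eigenvalues are the sorted roots of a characteristic polynomial, so the spectral
  theorem must first tie that list, multiplicities included, to an orthonormal eigenbasis. Their
  drift is read off from two stationarity equations instead; hence the care to show that the
  unconstrained critical point lies in the constraint set, where it obeys an equation and not merely
  a variational inequality. Noisy and noiseless trajectories are compared in mean square, where
  uncorrelated errors add as squares; the noiseless one is compared with the minimizers pointwise,
  where drifts add linearly. Hence the first bound is the root of a sum and the second a plain
  sum.\<close>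

lemma linear_coeff_zero_if_quadratic_nonneg:
  fixes b q :: real
  assumes "\<And>t. 0 \<le> 2 * t * b + t\<^sup>2 * q"
  shows "b = 0"
proof (rule ccontr)
  assume b: "b \<noteq> 0"
  define r where "r = \<bar>q\<bar> + 1"
  have r: "r > 0" "q \<le> r - 1" by (auto simp: r_def)
  have "0 \<le> 2 * (- b / r) * b + (- b / r)\<^sup>2 * q" by (rule assms)
  also have "\<dots> = (b / r)\<^sup>2 * (q - 2 * r)" using r
    by (simp add: field_simps power2_eq_square)
  also have "\<dots> < 0" using b r by (simp add: mult_pos_neg)
  finally show False by simp
qed

text \<open>The eigenvector maximizes the quadratic form \<open>x \<bullet> f x\<close> on the unit
  sphere of \<open>S\<close>, which is compact. Invariance of \<open>S\<close> keeps the residual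
  \<open>c *\<^sub>R v - f v\<close> in \<open>S\<close>, so its orthogonality to \<open>S\<close>
  forces it to vanish.\<close>

lemma selfadjoint_eigenvector_in_subspace:
  fixes f :: "'a::euclidean_space \<Rightarrow> 'a"
  assumes lin: "linear f" and sym: "\<And>x y. f x \<bullet> y = x \<bullet> f y"
    and S: "subspace S" "f ` S \<subseteq> S" "S \<noteq> {0}"
  shows "\<exists>v\<in>S. \<exists>c. norm v = 1 \<and> f v = c *\<^sub>R v"
proof -
  obtain z where z: "z \<in> S" "z \<noteq> 0" using S subspace_0 by blast
  have "compact (S \<inter> sphere 0 1)"
    by (simp add: closed_Int_compact closed_subspace S)
  moreover have "(1 / norm z) *\<^sub>R z \<in> S \<inter> sphere 0 1"
    using z S by (auto simp: subspace_scale)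
  moreover have "continuous_on (S \<inter> sphere 0 1) (\<lambda>x. x \<bullet> f x)"
    by (intro continuous_intros linear_continuous_on linear_conv_bounded_linear[THEN iffD1] lin)
  ultimately obtain v where v: "v \<in> S \<inter> sphere 0 1"
    and max: "\<forall>y \<in> S \<inter> sphere 0 1. y \<bullet> f y \<le> v \<bullet> f v"
    using continuous_attains_sup[of "S \<inter> sphere 0 1" "\<lambda>x. x \<bullet> f x"] by blast
  define c where "c = v \<bullet> f v"
  have vv: "v \<bullet> v = 1" "v \<in> S" using v by (auto simp: dot_square_norm)
  have q: "0 \<le> c * (x \<bullet> x) - x \<bullet> f x" if "x \<in> S" for x
  proof (cases "x = 0")
    case False
    have "(1 / norm x) *\<^sub>R x \<in> S \<inter> sphere 0 1"
      using that S False by (auto simp: subspace_scale)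
    then have "((1 / norm x) *\<^sub>R x) \<bullet> f ((1 / norm x) *\<^sub>R x) \<le> c"
      using max unfolding c_def by blast
    then have "(x \<bullet> f x) / (norm x)\<^sup>2 \<le> c"
      by (simp add: linear_cmul[OF lin] power2_eq_square)
    then show ?thesis using False by (simp add: field_simps dot_square_norm)
  qed (simp add: linear_0[OF lin])
  \<comment> \<open>First-order condition at the maximizer: along \<open>v + t *\<^sub>R y\<close>
    the nonnegative form in \<open>q\<close> is a quadratic in \<open>t\<close> without constant
    term, so its linear coefficient is zero.\<close>
  have "(c *\<^sub>R v - f v) \<bullet> y = 0" if y: "y \<in> S" for y
  proof (rule linear_coeff_zero_if_quadratic_nonneg)
    fix t :: real
    have "v + t *\<^sub>R y \<in> S" using vv y S by (simp add: subspace_add subspace_scale)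
    from q[OF this] show "0 \<le> 2 * t * ((c *\<^sub>R v - f v) \<bullet> y) + t\<^sup>2 * (c * (y \<bullet> y) - y \<bullet> f y)"
      using vv sym[of v y] sym[of y v]
      by (simp add: linear_add[OF lin] linear_cmul[OF lin] inner_simps power2_eq_square
        algebra_simps inner_commute c_def[symmetric])
  qed
  moreover have "c *\<^sub>R v - f v \<in> S" using vv S
    by (auto intro!: subspace_diff subspace_scale)
  ultimately have "c *\<^sub>R v - f v = 0" by (metis inner_eq_zero_iff)
  then have "f v = c *\<^sub>R v" by simp
  then show ?thesis using v by auto
qed

text \<open>Induction on the dimension of the invariant subspace: after a unit eigenvector is split
  off, symmetry keeps its orthogonal complement in \<open>S\<close> invariant.\<close>

lemma selfadjoint_orthonormal_eigenbasis:
  fixes f :: "'a::euclidean_space \<Rightarrow> 'a"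
  assumes lin: "linear f" and sym: "\<And>x y. f x \<bullet> y = x \<bullet> f y"
    and S: "subspace S" "f ` S \<subseteq> S"
  shows "\<exists>B\<subseteq>S. pairwise orthogonal B \<and> span B = S \<and> (\<forall>v\<in>B. norm v = 1 \<and> (\<exists>c. f v = c *\<^sub>R v))"
  using S
proof (induction "dim S" arbitrary: S rule: less_induct)
  case (less S)
  show ?case
  proof (cases "S = {0}")
    case True then show ?thesis by (intro exI[of _ "{}"]) auto
  next
    case False
    obtain v c where v: "v \<in> S" "norm v = 1" "f v = c *\<^sub>R v"
      using selfadjoint_eigenvector_in_subspace[OF lin sym less.prems False] by blast
    have vv: "v \<bullet> v = 1" using v by (simp add: dot_square_norm)
    define T where "T = {x \<in> S. v \<bullet> x = 0}"
    have T: "subspace T"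
      using less.prems(1) by (auto simp: T_def subspace_def inner_simps)
    have fT: "f ` T \<subseteq> T"
    proof
      fix y assume "y \<in> f ` T"
      then obtain x where x: "x \<in> S" "v \<bullet> x = 0" "y = f x" by (auto simp: T_def)
      then have "v \<bullet> f x = 0" using sym[of v x] v by simp
      then show "y \<in> T" using x less.prems(2) by (auto simp: T_def)
    qed
    have "v \<notin> T" using vv by (simp add: T_def)
    then have "T \<subset> S" using v unfolding T_def by blast
    then have "dim T < dim S"
      using T less.prems(1) by (intro dim_psubset) (simp add: span_eq_iff[THEN iffD2])
    from less.hyps[OF this T fT] obtain B where B: "B \<subseteq> T" "pairwise orthogonal B" "span B = T"
      "\<forall>v\<in>B. norm v = 1 \<and> (\<exists>c. f v = c *\<^sub>R v)" by blast
    have "S \<subseteq> span (insert v B)"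
    proof
      fix x assume x: "x \<in> S"
      have "x - (v \<bullet> x) *\<^sub>R v \<in> T" using x v vv less.prems(1)
        by (auto simp: T_def inner_simps subspace_diff subspace_scale)
      then show "x \<in> span (insert v B)" using B(3) by (auto simp: span_insert)
    qed
    moreover have "span (insert v B) \<subseteq> S"
      using v B \<open>T \<subset> S\<close> less.prems(1) by (intro span_minimal) auto
    moreover have "pairwise orthogonal (insert v B)"
      using B by (auto simp: pairwise_insert orthogonal_def T_def inner_commute)
    ultimately show ?thesis using v B \<open>T \<subset> S\<close>
      by (intro exI[of _ "insert v B"]) auto
  qed
qed

lemma symmetric_matrix_inner:
  fixes A :: "real^'n^'n"
  assumes "transpose A = A"
  shows "(A *v x) \<bullet> y = x \<bullet> (A *v y)"
  by (metis assms dot_lmul_matrix vector_transpose_matrix)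

text \<open>The basis is indexed by the type \<open>'n\<close> itself, so that its members can serve
  as the columns of a square matrix of the same format as \<open>A\<close>.\<close>

lemma symmetric_matrix_eigenbasis:
  fixes A :: "real^'n^'n"
  assumes sym: "transpose A = A"
  shows "\<exists>(u :: 'n \<Rightarrow> real^'n) l. (\<forall>i j. u i \<bullet> u j = (if i = j then 1 else 0)) \<and>
    (\<forall>i. A *v u i = l i *\<^sub>R u i) \<and> (\<forall>x. (\<Sum>i\<in>UNIV. (u i \<bullet> x) *\<^sub>R u i) = x)"
proof -
  from selfadjoint_orthonormal_eigenbasis[OF matrix_vector_mul_linear symmetric_matrix_inner[OF sym] subspace_UNIV]
  obtain B where B: "pairwise orthogonal B" "span B = UNIV"
    "\<forall>v\<in>B. norm v = 1 \<and> (\<exists>c. A *v v = c *\<^sub>R v)" by auto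
  have ind: "independent B" using B by (intro pairwise_orthogonal_independent) auto
  then have fin: "finite B" "card B = CARD('n)"
    using indep_card_eq_dim_span[OF ind] B(2) by auto
  then obtain u where u: "bij_betw u (UNIV :: 'n set) B"
    using finite_same_card_bij[of "UNIV :: 'n set" B] by auto
  have uB: "u i \<in> B" for i using u by (auto simp: bij_betw_def)
  have inj: "u i = u j \<longleftrightarrow> i = j" for i j using u by (auto simp: bij_betw_def inj_on_def)
  have on: "u i \<bullet> u j = (if i = j then 1 else 0)" for i j
    using B(1) uB[of i] uB[of j] inj[of i j] B(3)
    by (auto simp: pairwise_def orthogonal_def dot_square_norm)
  have "(\<Sum>i\<in>UNIV. (u i \<bullet> x) *\<^sub>R u i) = x" for x
  proof -
    have "x \<in> span B" using B by simp
    then obtain a where a: "x = (\<Sum>b\<in>B. a b *\<^sub>R b)"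
      using span_finite[OF fin(1)] by auto
    then have x: "x = (\<Sum>i\<in>UNIV. a (u i) *\<^sub>R u i)"
      using sum.reindex_bij_betw[OF u, of "\<lambda>b. a b *\<^sub>R b"] by simp
    have "u i \<bullet> x = a (u i)" for i
      unfolding x by (simp add: inner_sum_right on if_distrib[of "\<lambda>t. _ * t"] cong: if_cong)
    then show ?thesis using x by simp
  qed
  moreover have "\<forall>i. \<exists>c. A *v u i = c *\<^sub>R u i" using B(3) uB by blast
  from choice[OF this] obtain l where "\<forall>i. A *v u i = l i *\<^sub>R u i" by blast
  ultimately show ?thesis using on by blast
qed

text \<open>Diagonalization carried out over the polynomial ring: with the eigenvectors as columns
  of \<open>Q\<close>, the matrix \<open>M = xI - A\<close> satisfies \<open>M ** Q = Q ** D\<close>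
  with \<open>D\<close> diagonal. Determinants are multiplicative, and \<open>det Q\<close> cancels
  because it is a nonzero element of an integral domain.\<close>

lemma charpoly_eigenbasis:
  fixes A :: "real^'n^'n" and u :: "'n \<Rightarrow> real^'n"
  assumes on: "\<And>i j. u i \<bullet> u j = (if i = j then 1 else 0)" and ev: "\<And>i. A *v u i = l i *\<^sub>R u i"
  shows "charpoly A = (\<Prod>i\<in>UNIV. [:- l i, 1:])"
proof -
  define M :: "real poly^'n^'n" where "M = (\<chi> i j. [: - (A$i$j), (if i = j then 1 else 0) :])"
  define Q :: "real poly^'n^'n" where "Q = (\<chi> i j. [: u j $ i :])"
  define D :: "real poly^'n^'n" where "D = (\<chi> i j. if i = j then [:- l i, 1:] else 0)"
  have "transpose Q ** Q = mat 1"
  proof -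
    have "(\<Sum>k\<in>UNIV. [: u i $ k :] * [: u j $ k :]) = (if i = j then 1 else 0)" for i j
    proof -
      have "(\<Sum>k\<in>UNIV. [: u i $ k :] * [: u j $ k :]) = [: u i \<bullet> u j :]"
        by (simp add: inner_vec_def sum_to_poly mult.commute)
      then show ?thesis by (simp add: on one_pCons)
    qed
    then show ?thesis by (simp add: vec_eq_iff matrix_matrix_mult_def Q_def transpose_def mat_def)
  qed
  then have "det (transpose Q) * det Q = 1" by (metis det_I det_mul)
  then have Q0: "det Q \<noteq> 0" by auto
  have "M ** Q = Q ** D"
  proof -
    have "(\<Sum>k\<in>UNIV. [: - (A$i$k), (if i = k then 1 else 0) :] * [: u j $ k :]) = [: - l j * u j $ i, u j $ i :]" for i j
    proof -
      have "(\<Sum>k\<in>UNIV. A$i$k * u j $ k) = l j * u j $ i"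
        using ev[of j] by (simp add: vec_eq_iff matrix_vector_mult_def)
      moreover have "(\<Sum>k\<in>UNIV. [: - (A$i$k), (if i = k then 1 else 0) :] * [: u j $ k :])
        = [: - (\<Sum>k\<in>UNIV. A$i$k * u j $ k), (\<Sum>k\<in>UNIV. (if i = k then 1 else 0) * u j $ k) :]"
        by (rule poly_eqI) (auto simp: coeff_sum coeff_pCons sum_negf mult.commute split: nat.splits)
      ultimately show ?thesis by (simp add: if_distrib[of "\<lambda>t. t * _"] cong: if_cong)
    qed
    then show ?thesis
      by (simp add: vec_eq_iff matrix_matrix_mult_def Q_def M_def D_def if_distrib[of "\<lambda>t. _ * t"] mult.commute cong: if_cong)
  qed
  then have "det M * det Q = det Q * det D" by (metis det_mul)
  then have "det M = det D" using Q0 by simp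
  also have "\<dots> = (\<Prod>i\<in>UNIV. [:- l i, 1:])"
    by (subst det_diagonal) (auto simp: D_def)
  finally show ?thesis by (simp add: charpoly_def M_def)
qed

lemma mset_eigs_eigenbasis:
  fixes A :: "real^'n^'n" and u :: "'n \<Rightarrow> real^'n"
  assumes "\<And>i j. u i \<bullet> u j = (if i = j then 1 else 0)" "\<And>i. A *v u i = l i *\<^sub>R u i"
  shows "mset (eigs A) = image_mset l (mset_set UNIV)"
proof -
  have "proots (\<Prod>i\<in>I. [:- l i, 1:]) = image_mset l (mset_set I)" if "finite I" for I :: "'n set"
    using that
  proof (induction I)
    case (insert i I)
    have "(\<Prod>i\<in>I. [:- l i, 1:]) \<noteq> 0" using insert by (simp add: prod_zero_iff)
    then have "proots ([:- l i, 1:] * (\<Prod>i\<in>I. [:- l i, 1:])) = proots [:- l i, 1:] + proots (\<Prod>i\<in>I. [:- l i, 1:])"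
      by (intro proots_mult) auto
    then show ?case using insert by (simp only: prod.insert proots_linear_factor) simp
  qed simp
  then show ?thesis by (simp add: eigs_def charpoly_eigenbasis[OF assms])
qed

lemma eigenvalue_le_rho_card:
  fixes A :: "real^'n^'n" and u :: "'n \<Rightarrow> real^'n"
  assumes "\<And>i j. u i \<bullet> u j = (if i = j then 1 else 0)" "\<And>i. A *v u i = l i *\<^sub>R u i"
  shows "l i \<le> rho A CARD('n)"
proof -
  note m = mset_eigs_eigenbasis[OF assms]
  have "length (eigs A) = CARD('n)" using arg_cong[OF m, of size] by simp
  moreover have "l i \<in> set (eigs A)" using arg_cong[OF m, of set_mset] by simp
  ultimately obtain k where k: "k < CARD('n)" "eigs A ! k = l i" by (metis in_set_conv_nth)
  have "sorted (eigs A)" by (simp add: eigs_def)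
  then have "eigs A ! k \<le> eigs A ! (CARD('n) - 1)"
    using k \<open>length (eigs A) = _\<close> by (intro sorted_nth_mono) auto
  then show ?thesis using k by (simp add: rho_def)
qed

text \<open>In a sorted list only the first entry can lie strictly below the second. Since
  \<open>mset_eigs_eigenbasis\<close> respects multiplicities, this transfers to the indices of the
  eigenbasis and makes 0 a simple eigenvalue of a Laplacian with \<open>rho A 2 > 0\<close>.\<close>

lemma card_eigenvalues_less_rho2:
  fixes A :: "real^'n^'n" and u :: "'n \<Rightarrow> real^'n"
  assumes "\<And>i j. u i \<bullet> u j = (if i = j then 1 else 0)" "\<And>i. A *v u i = l i *\<^sub>R u i"
    and n: "CARD('n) \<ge> 2"
  shows "card {i. l i < rho A 2} \<le> 1"
proof -
  note m = mset_eigs_eigenbasis[OF assms(1,2)]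
  have len: "length (eigs A) = CARD('n)" using arg_cong[OF m, of size] by simp
  then obtain x y r where xs: "eigs A = x # y # r"
    using n by (cases "eigs A"; cases "tl (eigs A)") auto
  have "sorted (eigs A)" by (simp add: eigs_def)
  then have "filter (\<lambda>t. t < y) (y # r) = []" unfolding xs by (force simp: filter_empty_conv)
  then have le: "length (filter (\<lambda>t. t < rho A 2) (eigs A)) \<le> 1"
    by (simp add: rho_def xs)
  have "card {i. l i < rho A 2} = size (filter_mset (\<lambda>t. t < rho A 2) (mset (eigs A)))"
    unfolding m by (simp add: filter_mset_image_mset)
  also have "\<dots> = length (filter (\<lambda>t. t < rho A 2) (eigs A))"
    by (metis mset_filter size_mset)
  finally show ?thesis using le by simp
qed


text \<open>Zero row sums and symmetry remove the pure squares from the sum of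
  \<open>A$i$j * (x$i - x$j)\<^sup>2\<close> and leave \<open>- 2 * (x \<bullet> (A *v x))\<close>;
  the diagonal contributes nothing to that sum, and every other term is nonpositive.\<close>

lemma laplacian_quadratic_nonneg:
  fixes A :: "real^'n^'n"
  assumes sym: "transpose A = A" and off: "\<And>i j. i \<noteq> j \<Longrightarrow> A$i$j \<le> 0"
    and rows: "A *v (\<chi> i. 1) = 0"
  shows "0 \<le> x \<bullet> (A *v x)"
proof -
  have row: "(\<Sum>j\<in>UNIV. A$i$j) = 0" for i
    using rows by (simp add: vec_eq_iff matrix_vector_mult_def)
  have Asym: "A$i$j = A$j$i" for i j
    using sym by (simp add: vec_eq_iff transpose_def)
  have r1: "(\<Sum>i\<in>UNIV. \<Sum>j\<in>UNIV. A$i$j * (x$i)\<^sup>2) = 0"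
    by (simp add: row sum_distrib_right[symmetric])
  have r2: "(\<Sum>i\<in>UNIV. \<Sum>j\<in>UNIV. A$i$j * (x$j)\<^sup>2) = 0"
    by (subst sum.swap, subst Asym) (rule r1)
  have "(\<Sum>i\<in>UNIV. \<Sum>j\<in>UNIV. A$i$j * (x$i - x$j)\<^sup>2) = 
      (\<Sum>i\<in>UNIV. \<Sum>j\<in>UNIV. A$i$j * (x$i)\<^sup>2 + A$i$j * (x$j)\<^sup>2 - 2 * (x$i * (A$i$j * x$j)))"
    by (intro sum.cong refl) (simp add: power2_eq_square algebra_simps)
  also have "\<dots> = - 2 * (\<Sum>i\<in>UNIV. \<Sum>j\<in>UNIV. x$i * (A$i$j * x$j))"
    by (simp only: sum.distrib sum_subtractf r1 r2 sum_distrib_left[symmetric])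
  also have "(\<Sum>i\<in>UNIV. \<Sum>j\<in>UNIV. x$i * (A$i$j * x$j)) = x \<bullet> (A *v x)"
    by (simp add: inner_vec_def matrix_vector_mult_def sum_distrib_left)
  finally have eq: "(\<Sum>i\<in>UNIV. \<Sum>j\<in>UNIV. A$i$j * (x$i - x$j)\<^sup>2) = - 2 * (x \<bullet> (A *v x))" .
  have "(\<Sum>i\<in>UNIV. \<Sum>j\<in>UNIV. A$i$j * (x$i - x$j)\<^sup>2) \<le> 0"
  proof (intro sum_nonpos)
    fix i j show "A$i$j * (x$i - x$j)\<^sup>2 \<le> 0"
      using off[of i j] by (cases "i = j") (auto intro: mult_nonpos_nonneg)
  qed
  then show ?thesis using eq by simp
qed

lemma inner_eigenbasis_expansion:
  fixes u :: "'n::finite \<Rightarrow> real^'n"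
  assumes x: "(\<Sum>i\<in>UNIV. (u i \<bullet> x) *\<^sub>R u i) = x"
  shows "y \<bullet> x = (\<Sum>i\<in>UNIV. (u i \<bullet> x) * (u i \<bullet> y))"
  by (subst x[symmetric]) (simp add: inner_sum_right inner_commute)

text \<open>Everything is a weighted sum of the squares \<open>(u i \<bullet> x)\<^sup>2\<close>.
  The upper bound uses \<open>l i * l i \<le> rho A CARD('n) * l i\<close>; stating it with
  \<open>x \<bullet> (A *v x)\<close> on the right makes it a cocoercivity estimate.\<close>

lemma laplacian_spectral_bounds:
  fixes A :: "real^'n^'n"
  assumes sym: "transpose A = A" and off: "\<And>i j. i \<noteq> j \<Longrightarrow> A$i$j \<le> 0"
    and rows: "A *v (\<chi> i. 1) = 0" and n: "CARD('n) \<ge> 2" and pos: "rho A 2 > 0"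
  shows laplacian_upper: "(A *v x) \<bullet> (A *v x) \<le> rho A CARD('n) * (x \<bullet> (A *v x))"
    and laplacian_gap: "(\<Sum>i\<in>UNIV. x$i) = 0 \<Longrightarrow> rho A 2 * (x \<bullet> x) \<le> x \<bullet> (A *v x)"
    and rho_card_nonneg: "0 \<le> rho A CARD('n)"
proof -
  obtain u :: "'n \<Rightarrow> real^'n" and l where ul: "\<forall>i j. u i \<bullet> u j = (if i = j then 1 else 0)" "\<forall>i. A *v u i = l i *\<^sub>R u i"
    "\<forall>x. (\<Sum>i\<in>UNIV. (u i \<bullet> x) *\<^sub>R u i) = x"
    using symmetric_matrix_eigenbasis[OF sym] by blast
  note u = ul(1,2)[rule_format] and exp = ul(3)[rule_format]
  note ip = inner_eigenbasis_expansion[OF exp]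
  have l0: "0 \<le> l i" for i
    using laplacian_quadratic_nonneg[OF sym off rows, of "u i"] u by simp
  have lr: "l i \<le> rho A CARD('n)" for i by (rule eigenvalue_le_rho_card[OF u])
  show "0 \<le> rho A CARD('n)" by (rule order_trans[OF l0[of undefined] lr])
  have uA: "u i \<bullet> (A *v x) = l i * (u i \<bullet> x)" for i x
  proof -
    have "u i \<bullet> (A *v x) = (A *v u i) \<bullet> x" by (simp add: symmetric_matrix_inner[OF sym])
    then show ?thesis using u by simp
  qed
  have Axx: "x \<bullet> (A *v x) = (\<Sum>i\<in>UNIV. l i * (u i \<bullet> x)\<^sup>2)" for x
    using ip[of x "A *v x"] by (simp add: uA power2_eq_square mult_ac)
  have "(A *v x) \<bullet> (A *v x) = (\<Sum>i\<in>UNIV. l i * (l i * (u i \<bullet> x)\<^sup>2))"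
    using ip[of "A *v x" "A *v x"] by (simp add: uA power2_eq_square mult_ac)
  also have "\<dots> \<le> (\<Sum>i\<in>UNIV. rho A CARD('n) * (l i * (u i \<bullet> x)\<^sup>2))"
    using l0 lr by (intro sum_mono mult_right_mono) auto
  finally show "(A *v x) \<bullet> (A *v x) \<le> rho A CARD('n) * (x \<bullet> (A *v x))"
    by (simp add: Axx sum_distrib_left)
  let ?e = "(\<chi> i. 1) :: real^'n"
  assume x0: "(\<Sum>i\<in>UNIV. x$i) = 0"
  have ex: "?e \<bullet> x = 0" using x0 by (simp add: inner_vec_def)
  have le: "l i * (u i \<bullet> ?e) = 0" for i using uA[of i ?e] rows by simp
  have "\<exists>k. u k \<bullet> ?e \<noteq> 0"
  proof (rule ccontr)
    assume "\<not> ?thesis"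
    then have "?e = 0" using exp[of ?e, symmetric] by simp
    then show False by (simp add: vec_eq_iff)
  qed
  \<comment> \<open>The index of the kernel direction: \<open>l k\<close> must be 0, hence lies
    below \<open>rho A 2\<close>, and no other index does. The all-ones vector is therefore a
    multiple of \<open>u k\<close>, and a vector with zero sum has no component along it.\<close>
  then obtain k where k: "u k \<bullet> ?e \<noteq> 0" by blast
  then have "l k < rho A 2" using le[of k] pos by simp
  then have small: "l i < rho A 2 \<longleftrightarrow> i = k" for i
    using card_eigenvalues_less_rho2[OF u n] card_le_Suc0_iff_eq[of "{i. l i < rho A 2}"] by auto
  have ue: "u i \<bullet> ?e = 0" if "i \<noteq> k" for i
    using le[of i] small[of i] that pos by auto
  have "?e \<bullet> x = (u k \<bullet> x) * (u k \<bullet> ?e)"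
    unfolding ip[of ?e x] using ue by (subst sum.remove[of _ k]) (auto intro!: sum.neutral)
  then have uk: "u k \<bullet> x = 0" using ex k by simp
  have "rho A 2 * (x \<bullet> x) = (\<Sum>i\<in>UNIV. rho A 2 * (u i \<bullet> x)\<^sup>2)"
    by (subst ip) (simp add: sum_distrib_left power2_eq_square)
  also have "\<dots> \<le> (\<Sum>i\<in>UNIV. l i * (u i \<bullet> x)\<^sup>2)"
  proof (intro sum_mono)
    fix i show "rho A 2 * (u i \<bullet> x)\<^sup>2 \<le> l i * (u i \<bullet> x)\<^sup>2"
      using small[of i] uk by (cases "i = k") (auto intro: mult_right_mono)
  qed
  finally show "rho A 2 * (x \<bullet> x) \<le> x \<bullet> (A *v x)" by (simp add: Axx)
qed

text \<open>Lhat as an operator on stacked vectors.\<close>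
definition lapact :: "real^'n^'n \<Rightarrow> real^'d^'n \<Rightarrow> real^'d^'n" where
  "lapact A V = (\<chi> i. \<Sum>j\<in>UNIV. A$i$j *\<^sub>R V$j)"

lemma lapquad_eq_inner: "lapquad A V = V \<bullet> lapact A V"
  by (simp add: lapquad_def lapact_def inner_vec_def[of V] inner_sum_right)

lemma linear_lapact: "linear (lapact A)"
  by (rule linearI) (simp_all add: lapact_def vec_eq_iff sum.distrib scaleR_add_right
      sum_distrib_left scaleR_sum_right mult_ac)

lemma lapact_diff: "lapact A (V - W) = lapact A V - lapact A W"
  by (rule linear_diff[OF linear_lapact])

text \<open>Viewing a stacked vector as a family of vectors in \<open>real^'n\<close>, one per
  coordinate of \<open>'d\<close>, turns the Kronecker product into \<open>A\<close> acting on each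
  member, so every matrix estimate lifts by summation.\<close>

lemma inner_eq_sum_columns:
  fixes V W :: "real^'d^'n"
  shows "V \<bullet> W = (\<Sum>a\<in>UNIV. (\<chi> i. V$i$a) \<bullet> (\<chi> i. W$i$a))"
  by (simp add: inner_vec_def) (rule sum.swap)

lemma column_lapact: "(\<chi> i. lapact A V $ i $ a) = A *v (\<chi> i. V$i$a)"
  by (simp add: lapact_def matrix_vector_mult_def vec_eq_iff)

lemma lapact_symmetric:
  assumes "transpose A = A"
  shows "lapact A V \<bullet> W = V \<bullet> lapact A W"
  unfolding inner_eq_sum_columns column_lapact
  by (intro sum.cong refl symmetric_matrix_inner assms)

lemma lapact_consensus:
  assumes "A *v (\<chi> i. 1) = 0"
  shows "lapact A (\<chi> i. w) = 0"
proof -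
  have "(\<Sum>j\<in>UNIV. A$i$j) = 0" for i
    using assms by (simp add: vec_eq_iff matrix_vector_mult_def)
  then show ?thesis by (simp add: lapact_def vec_eq_iff scaleR_sum_left[symmetric] sum_distrib_right[symmetric])
qed

lemma lapact_spectral_bounds:
  fixes A :: "real^'n^'n" and V :: "real^'d^'n"
  assumes sym: "transpose A = A" and off: "\<And>i j. i \<noteq> j \<Longrightarrow> A$i$j \<le> 0"
    and rows: "A *v (\<chi> i. 1) = 0" and n: "CARD('n) \<ge> 2" and pos: "rho A 2 > 0"
  shows lapact_upper: "lapact A V \<bullet> lapact A V \<le> rho A CARD('n) * (V \<bullet> lapact A V)"
    and lapact_gap: "(\<Sum>i\<in>UNIV. V$i) = 0 \<Longrightarrow> rho A 2 * (V \<bullet> V) \<le> V \<bullet> lapact A V"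
    and lapact_nonneg: "0 \<le> V \<bullet> lapact A V"
proof -
  note L = laplacian_spectral_bounds[OF sym off rows n pos]
  show "lapact A V \<bullet> lapact A V \<le> rho A CARD('n) * (V \<bullet> lapact A V)"
    unfolding inner_eq_sum_columns column_lapact sum_distrib_left by (intro sum_mono L)
  show "0 \<le> V \<bullet> lapact A V"
    unfolding inner_eq_sum_columns column_lapact
    by (intro sum_nonneg laplacian_quadratic_nonneg[OF sym off rows])
  assume "(\<Sum>i\<in>UNIV. V$i) = 0"
  then have "(\<Sum>i\<in>UNIV. V$i$a) = 0" for a by (simp add: vec_eq_iff)
  then have "(\<Sum>i\<in>UNIV. (\<chi> i. V$i$a)$i) = 0" for a
    by (subst sum.cong[OF refl vec_lambda_beta]) auto
  then show "rho A 2 * (V \<bullet> V) \<le> V \<bullet> lapact A V"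
    unfolding inner_eq_sum_columns column_lapact sum_distrib_left by (intro sum_mono L)
qed

section \<open>Smooth strongly convex functions\<close>

lemma grad_eqI: "GDERIV g x :> D \<Longrightarrow> grad g x = D"
proof -
  assume D: "GDERIV g x :> D"
  have "E = D" if "GDERIV g x :> E" for E
  proof -
    have "(\<lambda>h. h \<bullet> E) = (\<lambda>h. h \<bullet> D)"
      using D that unfolding gderiv_def by (rule has_derivative_unique[rotated])
    then have "(E - D) \<bullet> E = (E - D) \<bullet> D" by metis
    then show "E = D" by (metis eq_iff_diff_eq_0 inner_diff_right inner_eq_zero_iff)
  qed
  with D show ?thesis unfolding grad_def by (rule the_equality)
qed

lemma GDERIV_grad:
  fixes g :: "'a::euclidean_space \<Rightarrow> real"
  assumes "g differentiable (at x)"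
  shows "GDERIV g x :> grad g x"
proof -
  obtain g' where g': "(g has_derivative g') (at x)" using assms by (auto simp: differentiable_def)
  interpret g': linear g' using g' has_derivative_linear by blast
  define D where "D = (\<Sum>b\<in>Basis. g' b *\<^sub>R b)"
  have "g' h = h \<bullet> D" for h
  proof -
    have "g' h = g' (\<Sum>b\<in>Basis. (h \<bullet> b) *\<^sub>R b)" by (simp add: euclidean_representation)
    then show ?thesis by (simp add: g'.sum g'.scale D_def inner_sum_right mult.commute)
  qed
  then have "g' = (\<lambda>h. h \<bullet> D)" by blast
  then have "GDERIV g x :> D" using g' by (simp add: gderiv_def)
  then show ?thesis using grad_eqI by metis
qed

lemma GDERIV_along_line:
  assumes "GDERIV g (x + t *\<^sub>R d) :> D"
  shows "((\<lambda>t. g (x + t *\<^sub>R d)) has_real_derivative (d \<bullet> D)) (at t within S)"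
proof -
  have "((\<lambda>t. x + t *\<^sub>R d) has_derivative (\<lambda>t. t *\<^sub>R d)) (at t within S)"
    by (auto intro!: derivative_eq_intros)
  from has_derivative_compose[OF this assms[unfolded gderiv_def]]
  show ?thesis by (simp add: has_field_derivative_def mult_commute_abs)
qed

lemma convex_on_ge_tangent:
  assumes cvx: "convex_on UNIV h" and D: "GDERIV h x :> D"
  shows "h x + (y - x) \<bullet> D \<le> h y"
proof -
  define p where "p t = h (x + t *\<^sub>R (y - x))" for t :: real
  have "convex_on UNIV p"
  proof (rule convex_onI)
    fix t a b :: real assume t: "0 < t" "t < 1"
    have "x + ((1 - t) *\<^sub>R a + t *\<^sub>R b) *\<^sub>R (y - x)
      = (1 - t) *\<^sub>R (x + a *\<^sub>R (y - x)) + t *\<^sub>R (x + b *\<^sub>R (y - x))"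
      by (simp add: algebra_simps)
    then show "p ((1 - t) *\<^sub>R a + t *\<^sub>R b) \<le> (1 - t) * p a + t * p b"
      unfolding p_def using t by (simp only:) (rule convex_onD[OF cvx], auto)
  qed simp
  moreover have "(p has_real_derivative ((y - x) \<bullet> D)) (at 0)"
    unfolding p_def using D by (intro GDERIV_along_line) simp
  ultimately have "p 1 - p 0 \<ge> ((y - x) \<bullet> D) * (1 - 0)"
    by (intro convex_on_imp_above_tangent[of UNIV p]) auto
  then show ?thesis by (simp add: p_def)
qed

lemma norm_sq_diff_expand:
  fixes x y :: "'a::real_inner"
  shows "(norm (y - x))\<^sup>2 = (norm y)\<^sup>2 - (norm x)\<^sup>2 - 2 * ((y - x) \<bullet> x)"
  by (simp add: power2_norm_eq_inner inner_simps inner_commute)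

locale smooth_strongly_convex =
  fixes g :: "'a::euclidean_space \<Rightarrow> real" and mu L :: real
  assumes mu_pos: "0 < mu" and mu_le_L: "mu \<le> L"
    and differentiable: "g differentiable (at x)"
    and smooth: "norm (grad g x - grad g y) \<le> L * norm (x - y)"
    and sconvex: "convex_on UNIV (\<lambda>x. g x - mu / 2 * (norm x)\<^sup>2)"
begin

lemma GDERIV: "GDERIV g x :> grad g x"
  by (rule GDERIV_grad[OF differentiable])

lemma ge_quadratic: "g x + (y - x) \<bullet> grad g x + mu / 2 * (norm (y - x))\<^sup>2 \<le> g y"
proof -
  have "GDERIV (\<lambda>x. g x - mu / 2 * (norm x)\<^sup>2) x :> grad g x - mu *\<^sub>R x"
    using GDERIV[of x] unfolding gderiv_def power2_norm_eq_inner
    by (auto intro!: derivative_eq_intros simp: inner_simps inner_commute)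
  from convex_on_ge_tangent[OF sconvex this, of y] show ?thesis
    by (simp add: norm_sq_diff_expand inner_simps field_simps)
qed

lemma strongly_monotone: "mu * (norm (x - y))\<^sup>2 \<le> (x - y) \<bullet> (grad g x - grad g y)"
  using ge_quadratic[of x y] ge_quadratic[of y x]
  by (simp add: inner_simps norm_minus_commute algebra_simps)

text \<open>The descent lemma. Subtracting the linear and quadratic terms along the segment leaves a
  function \<open>p\<close> whose derivative is nonpositive by the Lipschitz bound, so monotonicity
  replaces an integral of the gradient.\<close>

lemma le_quadratic: "g y \<le> g x + (y - x) \<bullet> grad g x + L / 2 * (norm (y - x))\<^sup>2"
proof -
  define d where "d = y - x"
  define p where "p t = g (x + t *\<^sub>R d) - t * (d \<bullet> grad g x) - L / 2 * (norm d)\<^sup>2 * t\<^sup>2" for t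
  have "p 1 \<le> p 0"
  proof (rule DERIV_nonpos_imp_nonincreasing[of 0 1 p])
    fix t :: real assume t: "0 \<le> t" "t \<le> 1"
    have "d \<bullet> (grad g (x + t *\<^sub>R d) - grad g x) \<le> norm d * norm (grad g (x + t *\<^sub>R d) - grad g x)"
      by (rule norm_cauchy_schwarz)
    also have "\<dots> \<le> norm d * (L * (t * norm d))"
      using smooth[of "x + t *\<^sub>R d" x] t by (intro mult_left_mono) auto
    finally have "d \<bullet> grad g (x + t *\<^sub>R d) - d \<bullet> grad g x - L * (norm d)\<^sup>2 * t \<le> 0"
      by (simp add: inner_simps power2_eq_square algebra_simps)
    moreover have "(p has_real_derivative (d \<bullet> grad g (x + t *\<^sub>R d) - d \<bullet> grad g x - L * (norm d)\<^sup>2 * t)) (at t)"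
      unfolding p_def
      by (rule derivative_eq_intros GDERIV_along_line[OF GDERIV] refl | simp)+
    ultimately show "\<exists>y. DERIV p t :> y \<and> y \<le> 0" by blast
  qed simp
  then show ?thesis by (simp add: p_def d_def algebra_simps)
qed

text \<open>Baillon--Haddad, applied to the convex function \<open>g - mu/2 |\<cdot>|\<^sup>2\<close>: compare its lower bound at
  \<open>x\<close> and its upper bound at \<open>y\<close> in the point reached from \<open>y\<close> by a gradient step.\<close>
lemma cocoercive:
  assumes D_def: "D = grad g x - grad g y - mu *\<^sub>R (x - y)"
  shows "D \<bullet> D \<le> (L - mu) * (D \<bullet> (x - y))"
proof -
  define H where "H z = g z - mu / 2 * (z \<bullet> z)" for z
  define G where "G z = grad g z - mu *\<^sub>R z" for z
  have lo: "H x + (y - x) \<bullet> G x \<le> H y" for x y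
    using ge_quadratic[of x y]
    by (simp add: H_def G_def power2_norm_eq_inner inner_simps inner_commute field_simps)
  have up: "H y \<le> H x + (y - x) \<bullet> G x + (L - mu) / 2 * ((y - x) \<bullet> (y - x))" for x y
    using le_quadratic[of y x]
    by (simp add: H_def G_def power2_norm_eq_inner inner_simps inner_commute field_simps)
  \<comment> \<open>The step length \<open>t\<close> stays free, because the optimal value
    \<open>1 / (L - mu)\<close> has no meaning when \<open>L = mu\<close>.\<close>
  have one: "H x + (y - x) \<bullet> G x + t * ((G y - G x) \<bullet> (G y - G x))
      - (L - mu) / 2 * t\<^sup>2 * ((G y - G x) \<bullet> (G y - G x)) \<le> H y" for x y t
    using lo[of x "y - t *\<^sub>R (G y - G x)"] up[of "y - t *\<^sub>R (G y - G x)" y]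
    by (simp add: inner_simps inner_commute field_simps power2_eq_square)
  have D: "D = G x - G y" by (simp add: D_def G_def algebra_simps)
  have all: "(2 * t - (L - mu) * t\<^sup>2) * (D \<bullet> D) \<le> D \<bullet> (x - y)" for t
  proof -
    have "(G y - G x) \<bullet> (G y - G x) = D \<bullet> D" "(G x - G y) \<bullet> (G x - G y) = D \<bullet> D"
      unfolding D by (simp_all add: inner_simps inner_commute algebra_simps)
    moreover have "(y - x) \<bullet> G x + (x - y) \<bullet> G y = - (D \<bullet> (x - y))"
      unfolding D by (simp add: inner_simps inner_commute algebra_simps)
    ultimately show ?thesis using one[of x y t] one[of y x t]
      by (simp only:) (simp add: algebra_simps diff_divide_distrib)
  qed
  show ?thesis
  proof (cases "L = mu")
    case False
    then have L: "L - mu > 0" using mu_le_L by simp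
    have "(2 * (1 / K) - K * (1 / K)\<^sup>2) * a = a / K" if "K > 0" for K a :: real
      using that by (simp add: field_simps power2_eq_square)
    from this[OF L, of "D \<bullet> D"]
    have "(2 * (1 / (L - mu)) - (L - mu) * (1 / (L - mu))\<^sup>2) * (D \<bullet> D) = (D \<bullet> D) / (L - mu)" .
    with all[of "1 / (L - mu)"] have "(D \<bullet> D) / (L - mu) \<le> D \<bullet> (x - y)" by simp
    then show ?thesis using L by (simp add: pos_divide_le_eq mult.commute)
  next
    case True
    \<comment> \<open>For \<open>L = mu\<close> the bound \<open>all\<close> is linear in
      \<open>t\<close>, so a nonzero \<open>D\<close> would violate it for large \<open>t\<close>;
      the witness makes the left side exceed the right by exactly 1.\<close>
    have "D \<bullet> D = 0"
    proof (rule ccontr)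
      assume "D \<bullet> D \<noteq> 0"
      moreover have "(2 * ((p + 1) / (2 * q))) * q = p + 1" if "q \<noteq> 0" for p q :: real
        using that by simp
      ultimately show False using all[of "(D \<bullet> (x - y) + 1) / (2 * (D \<bullet> D))"] True by simp
    qed
    then show ?thesis using True by simp
  qed
qed

end

section \<open>Sums of cocoercive terms and contraction of gradient steps\<close>

lemma inner_le_zero_iff: "x \<bullet> x \<le> 0 \<longleftrightarrow> x = 0" for x :: "'a::real_inner"
  by (metis inner_gt_zero_iff inner_zero_left not_le order_refl)

text \<open>The moduli add, by the weighted inequality
  \<open>|A + B|^2 <= (a + b) (|A|^2 / a + |B|^2 / b)\<close>, here multiplied by
  \<open>a * b\<close>. A zero modulus forces its vector to be zero and is treated apart.\<close>

lemma cocoercive_add: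
  fixes A B d :: "'a::real_inner"
  assumes ab: "0 \<le> a" "0 \<le> b" and A: "A \<bullet> A \<le> a * (A \<bullet> d)" and B: "B \<bullet> B \<le> b * (B \<bullet> d)"
  shows "(A + B) \<bullet> (A + B) \<le> (a + b) * ((A + B) \<bullet> d)"
proof (cases "a = 0 \<or> b = 0")
  case True
  then have "A = 0 \<and> a = 0 \<or> B = 0 \<and> b = 0" using A B by (auto simp: inner_le_zero_iff)
  then show ?thesis using A B by auto
next
  case False
  then have pos: "a > 0" "b > 0" using ab by auto
  have "0 \<le> (b *\<^sub>R A - a *\<^sub>R B) \<bullet> (b *\<^sub>R A - a *\<^sub>R B)" by simp
  then have c: "2 * (a * b) * (A \<bullet> B) \<le> b\<^sup>2 * (A \<bullet> A) + a\<^sup>2 * (B \<bullet> B)"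
    by (simp add: inner_simps inner_commute power2_eq_square algebra_simps)
  have "a * b * ((A + B) \<bullet> (A + B)) = a * b * (A \<bullet> A) + a * b * (B \<bullet> B) + 2 * (a * b) * (A \<bullet> B)"
    by (simp add: inner_simps inner_commute algebra_simps)
  also have "\<dots> \<le> (a + b) * (b * (A \<bullet> A) + a * (B \<bullet> B))"
    using c by (simp add: algebra_simps power2_eq_square)
  also have "\<dots> \<le> (a + b) * (b * (a * (A \<bullet> d)) + a * (b * (B \<bullet> d)))"
    using A B ab by (intro mult_left_mono add_mono) auto
  also have "\<dots> = a * b * ((a + b) * ((A + B) \<bullet> d))"
    by (simp add: inner_simps algebra_simps)
  finally show ?thesis using pos by simp
qed

text \<open>Here \<open>d\<close> is the difference of two points and \<open>h\<close> their
  gradient difference after \<open>m *\<^sub>R d\<close> has been taken out. In the expanded square,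
  cocoercivity merges the terms in \<open>h\<close> into
  \<open>- (t * (h \<bullet> d)) * (2 - t * (2 * m + K))\<close>, whose sign is the step size
  condition.\<close>

lemma gradient_step_contraction:
  fixes h d :: "'a::real_inner"
  assumes coc: "h \<bullet> h \<le> K * (h \<bullet> d)" and K: "0 \<le> K" and t: "0 \<le> t" "t * m \<le> 1" "t * (2 * m + K) \<le> 2"
  shows "norm ((1 - t * m) *\<^sub>R d - t *\<^sub>R h) \<le> (1 - t * m) * norm d"
proof (rule power2_le_imp_le)
  have hd: "0 \<le> h \<bullet> d"
  proof (cases "K = 0")
    case True
    then have "h = 0" using coc by (simp add: inner_le_zero_iff)
    then show ?thesis by simp
  next
    case False
    have "0 \<le> K * (h \<bullet> d)" using coc inner_ge_zero order_trans by blast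
    then show ?thesis using K False by (simp add: zero_le_mult_iff)
  qed
  have "(norm ((1 - t * m) *\<^sub>R d - t *\<^sub>R h))\<^sup>2
    = (1 - t * m)\<^sup>2 * (d \<bullet> d) - 2 * t * (1 - t * m) * (h \<bullet> d) + t\<^sup>2 * (h \<bullet> h)"
    unfolding power2_norm_eq_inner
    by (simp add: inner_diff_left inner_diff_right inner_commute power2_eq_square algebra_simps)
  also have "\<dots> \<le> (1 - t * m)\<^sup>2 * (d \<bullet> d) - 2 * t * (1 - t * m) * (h \<bullet> d) + t\<^sup>2 * (K * (h \<bullet> d))"
    using coc by (intro add_left_mono mult_left_mono) auto
  also have "\<dots> = (1 - t * m)\<^sup>2 * (d \<bullet> d) - (t * (h \<bullet> d)) * (2 - t * (2 * m + K))"
    by (simp add: power2_eq_square algebra_simps)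
  also have "\<dots> \<le> (1 - t * m)\<^sup>2 * (d \<bullet> d)"
    using hd t by simp
  finally show "(norm ((1 - t * m) *\<^sub>R d - t *\<^sub>R h))\<^sup>2 \<le> ((1 - t * m) * norm d)\<^sup>2"
    by (simp add: power_mult_distrib power2_norm_eq_inner)
qed (use t in auto)

section \<open>The penalized problem on a network\<close>

lemma norm_sq_vec_eq_sum: "(norm V)\<^sup>2 = (\<Sum>i\<in>UNIV. (norm (V $ i))\<^sup>2)"
  for V :: "'a::real_inner^'n"
  by (simp add: power2_norm_eq_inner inner_vec_def)

lemma norm_vec_le_sqrt_card:
  fixes V :: "'a::real_inner^'n"
  assumes "\<And>i. norm (V $ i) \<le> b"
  shows "norm V \<le> sqrt (real CARD('n)) * b"
proof -
  have b: "0 \<le> b" by (rule order_trans[OF norm_ge_zero assms[of undefined]])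
  have "(norm V)\<^sup>2 \<le> (\<Sum>i\<in>(UNIV::'n set). b\<^sup>2)"
    unfolding norm_sq_vec_eq_sum by (intro sum_mono power_mono assms norm_ge_zero)
  also have "\<dots> = (sqrt (real CARD('n)) * b)\<^sup>2" by (simp add: power_mult_distrib)
  finally show ?thesis by (rule power2_le_imp_le) (simp add: b)
qed

lemma inner_replicate_vec: "(\<chi> i. m) \<bullet> V = m \<bullet> (\<Sum>i\<in>UNIV. V$i)" for V :: "'a::real_inner^'n"
  by (simp add: inner_vec_def inner_sum_right)

text \<open>Pairing with a consensus vector moves the operator, by symmetry, onto an element of its
  kernel.\<close>

lemma sum_lapact:
  assumes sym: "transpose A = A" and rows: "A *v (\<chi> i. 1) = 0"
  shows "(\<Sum>i\<in>UNIV. lapact A V $ i) = 0"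
proof -
  have "m \<bullet> (\<Sum>i\<in>UNIV. lapact A V $ i) = 0" for m
    unfolding inner_replicate_vec[symmetric]
    by (subst lapact_symmetric[OF sym, symmetric]) (simp add: lapact_consensus[OF rows])
  then show ?thesis by (metis inner_eq_zero_iff)
qed

locale network =
  fixes f :: "'n::finite \<Rightarrow> real^'d::finite \<Rightarrow> real" and mu L :: real
    and Lap :: "real^'n^'n" and wstar :: "real^'d"
  assumes f: "\<And>i. smooth_strongly_convex (f i) mu L"
    and sym: "transpose Lap = Lap" and off: "\<And>i j. i \<noteq> j \<Longrightarrow> Lap$i$j \<le> 0"
    and rows: "Lap *v (\<chi> i. 1) = 0" and n: "CARD('n) \<ge> 2" and rho2: "rho Lap 2 > 0"
    and stationary_wstar: "(\<Sum>i\<in>UNIV. grad (f i) wstar) = 0"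
begin

abbreviation "rhoN \<equiv> rho Lap CARD('n)"

definition stackgrad :: "real^'d^'n \<Rightarrow> real^'d^'n" where
  "stackgrad V = (\<chi> i. grad (f i) (V$i))"

definition pengrad :: "real \<Rightarrow> real^'d^'n \<Rightarrow> real^'d^'n" where
  "pengrad c V = stackgrad V + c *\<^sub>R lapact Lap V"

definition Wstar :: "real^'d^'n" where
  "Wstar = (\<chi> i. wstar)"

definition nabla_star :: real where
  "nabla_star = (MAX i. norm (grad (f i) wstar))"

lemmas f_facts = smooth_strongly_convex.mu_pos[OF f] smooth_strongly_convex.mu_le_L[OF f]

lemma rhoN_nonneg: "0 \<le> rhoN"
  by (rule rho_card_nonneg[OF sym off rows n rho2])

lemma quad_nonneg: "0 \<le> V \<bullet> lapact Lap V" for V :: "real^'d^'n"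
  by (rule lapact_nonneg[OF sym off rows n rho2])

lemma grad_Gfun: "grad (Gfun f Lap c) V = pengrad c V"
proof (rule grad_eqI)
  have "((\<lambda>V. f i (V $ i)) has_derivative (\<lambda>h. h $ i \<bullet> grad (f i) (V $ i))) (at V)" for i
    using has_derivative_compose[OF bounded_linear_imp_has_derivative[OF bounded_linear_vec_nth]
      smooth_strongly_convex.GDERIV[OF f, unfolded gderiv_def]] .
  then have s: "((\<lambda>V. \<Sum>i\<in>UNIV. f i (V $ i)) has_derivative (\<lambda>h. h \<bullet> stackgrad V)) (at V)"
    unfolding inner_vec_def stackgrad_def vec_lambda_beta by (intro has_derivative_sum)
  have "(lapact Lap has_derivative lapact Lap) (at V)"
    by (intro linear_imp_has_derivative linear_lapact)
  from has_derivative_inner[OF has_derivative_ident this]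
  have "((\<lambda>V. V \<bullet> lapact Lap V) has_derivative (\<lambda>h. 2 * (h \<bullet> lapact Lap V))) (at V)"
    using lapact_symmetric[OF sym, of V] by (simp add: inner_commute algebra_simps)
  from has_derivative_add[OF s has_derivative_mult_right[OF this, of "c / 2"]]
  show "GDERIV (Gfun f Lap c) V :> pengrad c V"
    unfolding gderiv_def Gfun_def lapquad_eq_inner pengrad_def by (simp add: inner_simps)
qed

lemma stackgrad_strongly_monotone:
  "mu * (norm (X - Y))\<^sup>2 \<le> (X - Y) \<bullet> (stackgrad X - stackgrad Y)"
proof -
  have "mu * (norm (X - Y))\<^sup>2 = (\<Sum>i\<in>UNIV. mu * (norm (X$i - Y$i))\<^sup>2)"
    by (simp add: norm_sq_vec_eq_sum[of "X - Y"] sum_distrib_left)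
  also have "\<dots> \<le> (X - Y) \<bullet> (stackgrad X - stackgrad Y)"
    unfolding inner_vec_def[of "X - Y"]
    by (intro sum_mono) (simp add: stackgrad_def smooth_strongly_convex.strongly_monotone[OF f])
  finally show ?thesis .
qed

lemma stackgrad_lipschitz: "norm (stackgrad X - stackgrad Y) \<le> L * norm (X - Y)"
proof (rule power2_le_imp_le)
  have "(norm (stackgrad X - stackgrad Y))\<^sup>2 \<le> (\<Sum>i\<in>UNIV. (L * norm (X$i - Y$i))\<^sup>2)"
    unfolding norm_sq_vec_eq_sum[of "stackgrad X - stackgrad Y"]
    by (intro sum_mono power_mono) (simp_all add: stackgrad_def smooth_strongly_convex.smooth[OF f])
  then show "(norm (stackgrad X - stackgrad Y))\<^sup>2 \<le> (L * norm (X - Y))\<^sup>2"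
    by (simp add: norm_sq_vec_eq_sum[of "X - Y"] sum_distrib_left power_mult_distrib)
  show "0 \<le> L * norm (X - Y)" using f_facts by simp
qed

lemma stackgrad_cocoercive:
  assumes "D = stackgrad X - stackgrad Y - mu *\<^sub>R (X - Y)"
  shows "D \<bullet> D \<le> (L - mu) * (D \<bullet> (X - Y))"
  unfolding inner_vec_def[of D] sum_distrib_left
proof (intro sum_mono)
  fix i
  have "D $ i = grad (f i) (X$i) - grad (f i) (Y$i) - mu *\<^sub>R (X$i - Y$i)"
    by (simp add: assms stackgrad_def)
  from smooth_strongly_convex.cocoercive[OF f this]
  show "D $ i \<bullet> D $ i \<le> (L - mu) * (D $ i \<bullet> (X - Y) $ i)" by simp
qed

text \<open>The gradient difference splits as \<open>mu *\<^sub>R (X - Y) + A + B\<close>, where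
  \<open>A\<close> is cocoercive with modulus \<open>L - mu\<close> and \<open>B\<close> with
  modulus \<open>c * rhoN\<close>. Then \<open>2 * mu + K\<close> becomes
  \<open>mu + L + c * rhoN\<close>; for \<open>t = eta k\<close> and
  \<open>c = gam k / eta k\<close> its product with \<open>t\<close> is the left side of
  (C1).\<close>

lemma pengrad_step_contraction:
  assumes c: "0 \<le> c" and t: "0 \<le> t" "t * (mu + L + c * rhoN) \<le> 2"
  shows "norm ((X - t *\<^sub>R pengrad c X) - (Y - t *\<^sub>R pengrad c Y)) \<le> (1 - t * mu) * norm (X - Y)"
    and "t * mu \<le> 1"
proof -
  define A where "A = stackgrad X - stackgrad Y - mu *\<^sub>R (X - Y)"
  define B where "B = c *\<^sub>R lapact Lap (X - Y)"
  have "0 \<le> c * rhoN" using c rhoN_nonneg by simp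
  then have "t * (mu + mu) \<le> t * (mu + L + c * rhoN)"
    using t f_facts by (intro mult_left_mono) linarith+
  then show tm: "t * mu \<le> 1" using t(2) by simp
  have A: "A \<bullet> A \<le> (L - mu) * (A \<bullet> (X - Y))" by (rule stackgrad_cocoercive[OF A_def])
  have "c\<^sup>2 * (lapact Lap (X - Y) \<bullet> lapact Lap (X - Y)) \<le> c\<^sup>2 * (rhoN * ((X - Y) \<bullet> lapact Lap (X - Y)))"
    by (intro mult_left_mono lapact_upper[OF sym off rows n rho2]) auto
  then have B: "B \<bullet> B \<le> c * rhoN * (B \<bullet> (X - Y))"
    by (simp add: B_def power2_eq_square inner_commute mult_ac)
  have "(A + B) \<bullet> (A + B) \<le> (L - mu + c * rhoN) * ((A + B) \<bullet> (X - Y))"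
    using f_facts c rhoN_nonneg by (intro cocoercive_add A B) auto
  then have "norm ((1 - t * mu) *\<^sub>R (X - Y) - t *\<^sub>R (A + B)) \<le> (1 - t * mu) * norm (X - Y)"
  proof (rule gradient_step_contraction)
    show "0 \<le> L - mu + c * rhoN" using \<open>0 \<le> c * rhoN\<close> f_facts by linarith
    show "t * (2 * mu + (L - mu + c * rhoN)) \<le> 2" using t(2) by (simp add: algebra_simps)
  qed (use t tm in auto)
  also have "(1 - t * mu) *\<^sub>R (X - Y) - t *\<^sub>R (A + B) = (X - t *\<^sub>R pengrad c X) - (Y - t *\<^sub>R pengrad c Y)"
    by (simp add: A_def B_def pengrad_def lapact_diff algebra_simps)
  finally show "norm ((X - t *\<^sub>R pengrad c X) - (Y - t *\<^sub>R pengrad c Y)) \<le> (1 - t * mu) * norm (X - Y)" .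
qed

lemma pengrad_zero_exists:
  assumes c: "0 \<le> c"
  shows "\<exists>U. pengrad c U = 0"
proof -
  \<comment> \<open>A gradient step of length \<open>1 / K\<close> is half as long as the
    contraction estimate permits, and its fixed points are exactly the zeros of
    \<open>pengrad c\<close>.\<close>
  define K where "K = mu + L + c * rhoN"
  have K: "K > 0" using f_facts c rhoN_nonneg by (auto simp: K_def intro!: add_pos_nonneg)
  then have t: "0 < 1 / K" "(1 / K) * (mu + L + c * rhoN) \<le> 2" by (auto simp: K_def)
  note con = pengrad_step_contraction[OF c less_imp_le[OF t(1)] t(2)]
  have "\<exists>!U. U - (1 / K) *\<^sub>R pengrad c U = U"
  proof (rule banach_fix_type)
    show "0 \<le> 1 - 1 / K * mu" using con(2) by simp
    show "1 - 1 / K * mu < 1" using K f_facts by simp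
    show "\<forall>X Y. dist (X - (1 / K) *\<^sub>R pengrad c X) (Y - (1 / K) *\<^sub>R pengrad c Y)
        \<le> (1 - 1 / K * mu) * dist X Y"
      unfolding dist_norm using con(1) by blast
  qed
  then show ?thesis using K by auto
qed

lemma Gfun_ge_quadratic:
  assumes c: "0 \<le> c"
  shows "Gfun f Lap c U + (V - U) \<bullet> pengrad c U + mu / 2 * (norm (V - U))\<^sup>2 \<le> Gfun f Lap c V"
proof -
  have "(\<Sum>i\<in>UNIV. f i (U$i)) + (V - U) \<bullet> stackgrad U + mu / 2 * (norm (V - U))\<^sup>2
    = (\<Sum>i\<in>UNIV. f i (U$i) + (V$i - U$i) \<bullet> grad (f i) (U$i) + mu / 2 * (norm (V$i - U$i))\<^sup>2)"
    by (simp add: inner_vec_def stackgrad_def norm_sq_vec_eq_sum sum.distrib sum_distrib_left)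
  also have "\<dots> \<le> (\<Sum>i\<in>UNIV. f i (V$i))"
    by (intro sum_mono smooth_strongly_convex.ge_quadratic[OF f])
  finally have 1: "(\<Sum>i\<in>UNIV. f i (U$i)) + (V - U) \<bullet> stackgrad U + mu / 2 * (norm (V - U))\<^sup>2
    \<le> (\<Sum>i\<in>UNIV. f i (V$i))" .
  have "0 \<le> c / 2 * ((V - U) \<bullet> lapact Lap (V - U))" using c quad_nonneg by simp
  also have "\<dots> = c / 2 * lapquad Lap V - c / 2 * lapquad Lap U - c * ((V - U) \<bullet> lapact Lap U)"
    using lapact_symmetric[OF sym, of V U]
    by (simp add: lapquad_eq_inner lapact_diff inner_simps inner_commute algebra_simps)
  finally show ?thesis using 1 by (simp add: Gfun_def pengrad_def inner_simps)
qed

text \<open>\<open>Gmin\<close> is a choice term, so a critical point in the set must be shown to be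
  the only minimizer there; the gap \<open>mu / 2 * (norm (V - U))\<^sup>2\<close> provides both
  minimality and uniqueness.\<close>

lemma Gmin_eqI:
  assumes c: "0 \<le> c" and U: "pengrad c U = 0" "U \<in> stackset S"
  shows "Gmin S f Lap c = U"
  unfolding Gmin_def
proof (rule some_equality)
  show "U \<in> stackset S \<and> (\<forall>V\<in>stackset S. Gfun f Lap c U \<le> Gfun f Lap c V)"
  proof (intro conjI ballI U)
    fix V
    have "0 \<le> mu / 2 * (norm (V - U))\<^sup>2" using f_facts by simp
    then show "Gfun f Lap c U \<le> Gfun f Lap c V" using Gfun_ge_quadratic[OF c, of U V] U by simp
  qed
next
  fix V assume V: "V \<in> stackset S \<and> (\<forall>U\<in>stackset S. Gfun f Lap c V \<le> Gfun f Lap c U)"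
  then have "mu / 2 * (norm (V - U))\<^sup>2 \<le> 0" using Gfun_ge_quadratic[OF c, of U V] U by force
  then show "V = U" using f_facts by (simp add: mult_le_0_iff)
qed

text \<open>The Laplacian controls only the disagreement part \<open>E\<close> of \<open>D = X - Y\<close>. Since the gradient
  difference \<open>h\<close> sums to zero over the nodes, \<open>mu |D|\<^sup>2 \<le> D \<bullet> h = E \<bullet> h\<close>, which lets \<open>E\<close>
  control \<open>D\<close> at the price of the condition number.\<close>
lemma norm_diff_le_perturbation:
  assumes s: "0 < s" and h: "h = stackgrad X - stackgrad Y" and h0: "(\<Sum>i\<in>UNIV. h $ i) = 0"
    and b: "s *\<^sub>R h + lapact Lap (X - Y) = b"
  shows "norm (X - Y) \<le> L / (mu * rho Lap 2) * norm b"
proof -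
  define D where "D = X - Y"
  define m where "m = (1 / real CARD('n)) *\<^sub>R (\<Sum>i\<in>UNIV. D $ i)"
  define E where "E = D - (\<chi> i. m)"
  have "(\<Sum>i\<in>(UNIV :: 'n set). m) = real CARD('n) *\<^sub>R m" by (rule sum_constant_scaleR)
  also have "\<dots> = (\<Sum>i\<in>UNIV. D $ i)" by (simp add: m_def)
  finally have E0: "(\<Sum>i\<in>UNIV. E $ i) = 0"
    unfolding E_def by (simp only: sum_subtractf vector_minus_component vec_lambda_beta) simp
  have lE: "lapact Lap E = lapact Lap D" by (simp add: E_def lapact_diff lapact_consensus[OF rows])
  have Eh: "E \<bullet> h = D \<bullet> h" by (simp add: E_def inner_diff_left inner_replicate_vec h0)
  have mono: "mu * (norm D)\<^sup>2 \<le> D \<bullet> h" unfolding D_def h by (rule stackgrad_strongly_monotone)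
  have Dh: "0 \<le> D \<bullet> h" by (rule order_trans[OF _ mono]) (use f_facts in simp)
  have "rho Lap 2 * (E \<bullet> E) \<le> E \<bullet> lapact Lap E" by (rule lapact_gap[OF sym off rows n rho2 E0])
  also have "\<dots> \<le> E \<bullet> b" using Dh s unfolding b[symmetric] D_def[symmetric]
    by (simp add: inner_add_right lE Eh)
  also have "\<dots> \<le> norm E * norm b" by (rule norm_cauchy_schwarz)
  finally have "norm E * (rho Lap 2 * norm E) \<le> norm E * norm b"
    by (simp add: dot_square_norm power2_eq_square mult_ac)
  then have Eb: "rho Lap 2 * norm E \<le> norm b" by (cases "norm E = 0") auto
  have "mu * (norm D)\<^sup>2 \<le> norm E * norm h" using mono Eh norm_cauchy_schwarz[of E h] by simp
  also have "\<dots> \<le> norm E * (L * norm D)"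
    unfolding h D_def by (intro mult_left_mono stackgrad_lipschitz) auto
  finally have "norm D * (mu * norm D) \<le> norm D * (L * norm E)"
    by (simp add: power2_eq_square mult_ac)
  then have D: "mu * norm D \<le> L * norm E" using f_facts by (cases "norm D = 0") auto
  have "norm D * (mu * rho Lap 2) = rho Lap 2 * (mu * norm D)" by simp
  also have "\<dots> \<le> rho Lap 2 * (L * norm E)" using D rho2 by (intro mult_left_mono) auto
  also have "\<dots> \<le> L * norm b" using mult_left_mono[OF Eb, of L] f_facts by (simp add: mult_ac)
  finally show ?thesis using f_facts rho2 by (simp add: D_def field_simps)
qed

section \<open>Distance to consensus and drift of the penalized critical points\<close>

lemma lapact_stationary:
  assumes "pengrad c U = 0" "c \<noteq> 0"
  shows "lapact Lap U = - (1 / c) *\<^sub>R stackgrad U"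
proof -
  have "c *\<^sub>R lapact Lap U = - stackgrad U"
    using assms by (simp add: pengrad_def eq_neg_iff_add_eq_0 add.commute)
  then have "(1 / c) *\<^sub>R (c *\<^sub>R lapact Lap U) = (1 / c) *\<^sub>R (- stackgrad U)" by (simp only:)
  then show ?thesis using assms by simp
qed

lemma sum_stackgrad_stationary:
  assumes "pengrad c U = 0"
  shows "(\<Sum>i\<in>UNIV. stackgrad U $ i) = 0"
proof -
  have "stackgrad U = (- c) *\<^sub>R lapact Lap U" using assms by (simp add: pengrad_def eq_neg_iff_add_eq_0)
  then have "(\<Sum>i\<in>UNIV. stackgrad U $ i) = (- c) *\<^sub>R (\<Sum>i\<in>UNIV. lapact Lap U $ i)"
    by (simp add: scaleR_sum_right[symmetric] sum_negf)
  then show ?thesis by (simp add: sum_lapact[OF sym rows])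
qed

lemma sum_stackgrad_Wstar: "(\<Sum>i\<in>UNIV. stackgrad Wstar $ i) = 0"
  by (simp add: stackgrad_def Wstar_def stationary_wstar)

lemma norm_stackgrad_Wstar: "norm (stackgrad Wstar) \<le> sqrt (real CARD('n)) * nabla_star"
  by (rule norm_vec_le_sqrt_card) (auto simp: stackgrad_def Wstar_def nabla_star_def)

lemma nabla_star_nonneg: "0 \<le> nabla_star"
proof -
  have "norm (grad (f undefined) wstar) \<le> nabla_star" by (auto simp: nabla_star_def)
  then show ?thesis by (rule order_trans[OF norm_ge_zero])
qed

text \<open>Divided by \<open>c\<close>, the stationarity equation of \<open>U\<close> differs from
  the corresponding expression at \<open>Wstar\<close> by the residual
  \<open>- (1 / c) *\<^sub>R stackgrad Wstar\<close>; the perturbation estimate is applied with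
  \<open>s = 1 / c\<close>.\<close>

lemma consensus_error:
  assumes c: "0 < c" and U: "pengrad c U = 0"
  shows "norm (U - Wstar) \<le> sqrt (real CARD('n)) * (nabla_star * L / (mu * rho Lap 2) * (1 / c))"
proof -
  have "(1 / c) *\<^sub>R (stackgrad U - stackgrad Wstar) + lapact Lap (U - Wstar)
    = (1 / c) *\<^sub>R pengrad c U - (1 / c) *\<^sub>R stackgrad Wstar"
    using c by (simp add: pengrad_def lapact_diff Wstar_def lapact_consensus[OF rows] algebra_simps)
  then have "norm (U - Wstar) \<le> L / (mu * rho Lap 2) * norm (- (1 / c) *\<^sub>R stackgrad Wstar)"
    using c by (intro norm_diff_le_perturbation[of "1 / c", OF _ refl])
      (simp_all add: U sum_subtractf sum_stackgrad_Wstar sum_stackgrad_stationary[OF U])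
  also have "\<dots> = L / (mu * rho Lap 2) * (1 / c) * norm (stackgrad Wstar)" using c by simp
  also have "\<dots> \<le> L / (mu * rho Lap 2) * (1 / c) * (sqrt (real CARD('n)) * nabla_star)"
    using c f_facts rho2 by (intro mult_left_mono norm_stackgrad_Wstar) auto
  finally show ?thesis by (simp add: mult_ac)
qed

text \<open>Subtracting the two stationarity equations, each divided by its own penalty, leaves the
  residual \<open>- (1 / c - 1 / c') *\<^sub>R stackgrad U'\<close>. The gradient at
  \<open>U'\<close> is compared with that at \<open>Wstar\<close> through the consensus error, which
  is where the factor \<open>1 + L\<^sup>2 / (mu * rho Lap 2) * (1 / c)\<close> originates.\<close>

lemma minimizer_drift:
  assumes c: "0 < c" "c \<le> c'" and U: "pengrad c U = 0" and U': "pengrad c' U' = 0"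
  shows "norm (U - U') \<le> sqrt (real CARD('n)) * (nabla_star * L / (mu * rho Lap 2)
    * ((1 + L\<^sup>2 / (mu * rho Lap 2) * (1 / c)) * (1 / c - 1 / c')))"
proof -
  have c': "0 < c'" using c by simp
  have ic: "1 / c' \<le> 1 / c" using c by (simp add: frac_le)
  define K where "K = L / (mu * rho Lap 2)"
  have K: "0 \<le> K" using f_facts rho2 by (auto simp: K_def)
  have lap: "lapact Lap U = - (1 / c) *\<^sub>R stackgrad U" "lapact Lap U' = - (1 / c') *\<^sub>R stackgrad U'"
    using U U' c c' by (auto simp del: scaleR_minus_left intro!: lapact_stationary)
  have "(1 / c) *\<^sub>R (stackgrad U - stackgrad U') + lapact Lap (U - U')
    = - (1 / c - 1 / c') *\<^sub>R stackgrad U'"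
    by (simp only: lapact_diff lap) (simp add: algebra_simps)
  then have "norm (U - U') \<le> K * norm (- (1 / c - 1 / c') *\<^sub>R stackgrad U')"
    unfolding K_def using c by (intro norm_diff_le_perturbation[of "1 / c", OF _ refl])
      (simp_all add: sum_subtractf sum_stackgrad_stationary[OF U] sum_stackgrad_stationary[OF U'])
  also have "\<dots> = K * (1 / c - 1 / c') * norm (stackgrad U')" using ic by simp
  also have "\<dots> \<le> K * (1 / c - 1 / c') * (sqrt (real CARD('n)) * (nabla_star * (1 + L * K * (1 / c))))"
  proof (intro mult_left_mono)
    have "norm (stackgrad U') \<le> norm (stackgrad Wstar) + norm (stackgrad U' - stackgrad Wstar)"
      by (metis add.commute diff_add_cancel norm_triangle_ineq)
    also have "\<dots> \<le> sqrt (real CARD('n)) * nabla_star + L * norm (U' - Wstar)"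
      by (intro add_mono norm_stackgrad_Wstar stackgrad_lipschitz)
    also have "\<dots> \<le> sqrt (real CARD('n)) * nabla_star + L * (sqrt (real CARD('n)) * (nabla_star * K * (1 / c')))"
      using consensus_error[OF c' U'] f_facts
      by (intro add_left_mono mult_left_mono) (auto simp: K_def)
    \<comment> \<open>Weakening \<open>1 / c'\<close> to \<open>1 / c\<close> makes the correction
      factor depend on the earlier ratio \<open>eta t / gam t\<close>, as in the claimed
      bound.\<close>
    also have "\<dots> \<le> sqrt (real CARD('n)) * nabla_star + L * (sqrt (real CARD('n)) * (nabla_star * K * (1 / c)))"
      using ic f_facts K nabla_star_nonneg by (intro add_left_mono mult_left_mono) auto
    finally show "norm (stackgrad U') \<le> sqrt (real CARD('n)) * (nabla_star * (1 + L * K * (1 / c)))"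
      by (simp add: algebra_simps)
    show "0 \<le> K * (1 / c - 1 / c')" using K ic by simp
  qed
  also have "L * K = L\<^sup>2 / (mu * rho Lap 2)" by (simp add: K_def power2_eq_square)
  finally show ?thesis by (simp add: K_def mult_ac)
qed

lemma continuous_pengrad: "continuous_on UNIV (pengrad c)"
proof -
  have "continuous_on UNIV stackgrad"
  proof (rule lipschitz_on_continuous_on)
    show "L-lipschitz_on UNIV stackgrad"
      using stackgrad_lipschitz f_facts by (intro lipschitz_onI) (auto simp: dist_norm)
  qed
  moreover have "continuous_on UNIV (lapact Lap :: real^'d^'n \<Rightarrow> _)"
    by (rule linear_continuous_on[OF linear_conv_bounded_linear[THEN iffD1, OF linear_lapact]])
  ultimately show ?thesis unfolding pengrad_def by (intro continuous_on_add continuous_on_scaleR continuous_on_const)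
qed

end

section \<open>Projection, recursions and second moments\<close>

text \<open>The segment from \<open>w\<close> to an outside point meets the frontier. As
  \<open>S\<close> is closed, the meeting point is not \<open>y\<close> and is strictly nearer to
  \<open>w\<close>, so equality in the distance bound is still allowed.\<close>

lemma mem_if_norm_le_infdist_frontier:
  fixes w :: "'a::real_normed_vector"
  assumes S: "closed S" "w \<in> S" and y: "norm (y - w) \<le> infdist w (frontier S)"
  shows "y \<in> S"
proof (rule ccontr)
  assume "y \<notin> S"
  then have "closed_segment w y \<inter> frontier S \<noteq> {}"
    using S by (intro connected_Int_frontier) auto
  then obtain z where z: "z \<in> closed_segment w y" "z \<in> frontier S" by blast
  have "z \<in> S" using z S frontier_subset_closed by blast
  obtain u where u: "0 \<le> u" "u \<le> 1" "z = (1 - u) *\<^sub>R w + u *\<^sub>R y"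
    using z by (auto simp: in_segment)
  have "u < 1" using u \<open>z \<in> S\<close> \<open>y \<notin> S\<close> by (cases "u = 1") auto
  have "w \<noteq> y" using S \<open>y \<notin> S\<close> by auto
  have "z - w = u *\<^sub>R (y - w)" using u by (simp add: algebra_simps)
  then have "norm (z - w) = u * norm (y - w)" using u by simp
  also have "\<dots> < norm (y - w)" using \<open>u < 1\<close> \<open>w \<noteq> y\<close> by simp
  finally show False using y infdist_le[OF z(2), of w] by (simp add: dist_norm norm_minus_commute)
qed

lemma stackset_convex: "convex S \<Longrightarrow> convex (stackset S)"
  by (auto simp: stackset_def convex_def)

lemma stackset_closed: "closed S \<Longrightarrow> closed (stackset S :: ('a::real_normed_vector ^ 'n) set)"
proof -
  assume "closed S"
  then have "closed ((\<lambda>V::'a^'n. V $ i) -` S)" for i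
    by (intro closed_vimage continuous_intros) auto
  moreover have "stackset S = (\<Inter>i. (\<lambda>V::'a^'n. V $ i) -` S)" by (auto simp: stackset_def)
  ultimately show ?thesis by auto
qed

lemma norm_diff_stackset_le:
  fixes V U :: "'a::real_inner^'n"
  assumes S: "bounded S" and V: "V \<in> stackset S" and U: "U \<in> stackset S"
  shows "norm (V - U) \<le> sqrt (real CARD('n)) * diameter S"
proof (rule norm_vec_le_sqrt_card)
  fix i show "norm ((V - U) $ i) \<le> diameter S"
    using diameter_bounded_bound[OF S, of "V $ i" "U $ i"] V U
    by (simp add: stackset_def dist_norm)
qed

text \<open>Discrete variation of constants, used twice: with \<open>q\<close> the squared
  contraction factor for mean squares, and with the factor itself for distances.\<close>

lemma linear_recursion_bound:
  fixes a q s :: "nat \<Rightarrow> real"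
  assumes rec: "\<And>k. m \<le> k \<Longrightarrow> a (Suc k) \<le> q k * a k + s k" and q: "\<And>k. m \<le> k \<Longrightarrow> 0 \<le> q k"
    and "m \<le> k"
  shows "a k \<le> a m * (\<Prod>j\<in>{m..<k}. q j) + (\<Sum>t\<in>{m..<k}. (\<Prod>j\<in>{Suc t..<k}. q j) * s t)"
  using \<open>m \<le> k\<close>
proof (induction k rule: dec_induct)
  case (step k)
  have "a (Suc k) \<le> q k * a k + s k" using rec step by simp
  also have "\<dots> \<le> q k * (a m * (\<Prod>j\<in>{m..<k}. q j) + (\<Sum>t\<in>{m..<k}. (\<Prod>j\<in>{Suc t..<k}. q j) * s t)) + s k"
    using step q by (intro add_right_mono mult_left_mono) auto
  also have "\<dots> = a m * (\<Prod>j\<in>{m..<Suc k}. q j) + (\<Sum>t\<in>{m..<Suc k}. (\<Prod>j\<in>{Suc t..<Suc k}. q j) * s t)"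
  proof -
    have "(\<Sum>t\<in>{m..<k}. (\<Prod>j\<in>{Suc t..<Suc k}. q j) * s t) = q k * (\<Sum>t\<in>{m..<k}. (\<Prod>j\<in>{Suc t..<k}. q j) * s t)"
      unfolding sum_distrib_left by (intro sum.cong) (auto simp: prod.atLeastLessThan_Suc mult_ac)
    then show ?thesis using step
      by (simp add: prod.atLeastLessThan_Suc sum.atLeastLessThan_Suc algebra_simps)
  qed
  finally show ?case .
qed simp

section \<open>Second moments of conditionally centered perturbations\<close>

lemma enorm_le:
  assumes "prob_space M" and b: "0 \<le> b" "\<And>\<omega>. \<omega> \<in> space M \<Longrightarrow> norm (X \<omega>) \<le> b"
  shows "enorm M X \<le> b"
proof -
  interpret prob_space M by fact
  have "(LINT \<omega>|M. (norm (X \<omega>))\<^sup>2) \<le> (LINT \<omega>|M. b\<^sup>2)"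
    using b by (intro integral_mono') (auto intro!: power_mono)
  then show ?thesis using b by (simp add: enorm_def prob_space real_le_lsqrt)
qed

lemma integrable_norm_if_square:
  fixes Y :: "'w \<Rightarrow> 'a::euclidean_space"
  assumes M: "prob_space M" and Y: "Y \<in> borel_measurable M" "integrable M (\<lambda>\<omega>. (norm (Y \<omega>))\<^sup>2)"
  shows "integrable M (\<lambda>\<omega>. norm (Y \<omega>))"
proof -
  interpret prob_space M by fact
  show ?thesis
  proof (rule Bochner_Integration.integrable_bound)
    show "integrable M (\<lambda>\<omega>. 1 + (norm (Y \<omega>))\<^sup>2)" using Y(2) by simp
    show "(\<lambda>\<omega>. norm (Y \<omega>)) \<in> borel_measurable M" using Y(1) by measurable
    have "norm (Y \<omega>) \<le> 1 + (norm (Y \<omega>))\<^sup>2" for \<omega>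
    proof -
      have "2 * norm (Y \<omega>) \<le> (norm (Y \<omega>))\<^sup>2 + 1"
        using sum_squares_bound[of "norm (Y \<omega>)" 1] by simp
      then show ?thesis using norm_ge_zero[of "Y \<omega>"] by linarith
    qed
    then show "AE \<omega> in M. norm (norm (Y \<omega>)) \<le> norm (1 + (norm (Y \<omega>))\<^sup>2)"
      by (intro AE_I2) (simp add: abs_of_nonneg)
  qed
qed

text \<open>Coordinate by coordinate, the \<open>F\<close>-measurable factor is moved past the
  conditional expectation of \<open>Y\<close>, which vanishes. Boundedness of \<open>X\<close> and
  square integrability of \<open>Y\<close> make the products integrable.\<close>

lemma integral_inner_centered:
  fixes X Y :: "'w \<Rightarrow> 'a::euclidean_space"
  assumes M: "prob_space M" and F: "subalgebra M F"
    and X: "X \<in> borel_measurable F" "\<And>\<omega>. \<omega> \<in> space M \<Longrightarrow> norm (X \<omega>) \<le> K"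
    and Y: "Y \<in> borel_measurable M" "integrable M (\<lambda>\<omega>. (norm (Y \<omega>))\<^sup>2)"
    and mean: "\<And>b. b \<in> Basis \<Longrightarrow> AE \<omega> in M. real_cond_exp M F (\<lambda>\<omega>. Y \<omega> \<bullet> b) \<omega> = 0"
  shows "integrable M (\<lambda>\<omega>. X \<omega> \<bullet> Y \<omega>)" "(LINT \<omega>|M. X \<omega> \<bullet> Y \<omega>) = 0"
proof -
  interpret prob_space M by fact
  interpret finite_measure_subalgebra M F by unfold_locales fact
  have XM: "X \<in> borel_measurable M" using measurable_from_subalg[OF F X(1)] .
  have nY: "integrable M (\<lambda>\<omega>. norm (Y \<omega>))" using M Y by (rule integrable_norm_if_square)
  have int: "integrable M (\<lambda>\<omega>. (X \<omega> \<bullet> b) * (Y \<omega> \<bullet> b))" if b: "b \<in> Basis" for b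
  proof (rule Bochner_Integration.integrable_bound)
    show "integrable M (\<lambda>\<omega>. K * norm (Y \<omega>))" using nY by simp
    show "(\<lambda>\<omega>. (X \<omega> \<bullet> b) * (Y \<omega> \<bullet> b)) \<in> borel_measurable M" using XM Y by measurable
    show "AE \<omega> in M. norm ((X \<omega> \<bullet> b) * (Y \<omega> \<bullet> b)) \<le> norm (K * norm (Y \<omega>))"
    proof (rule AE_I2)
      fix \<omega> assume \<omega>: "\<omega> \<in> space M"
      have "\<bar>X \<omega> \<bullet> b\<bar> * \<bar>Y \<omega> \<bullet> b\<bar> \<le> K * norm (Y \<omega>)"
        using Basis_le_norm[OF b, of "X \<omega>"] Basis_le_norm[OF b, of "Y \<omega>"] X(2)[OF \<omega>]
        by (intro mult_mono) (auto intro: order_trans[OF norm_ge_zero])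
      moreover have "0 \<le> K" by (rule order_trans[OF norm_ge_zero X(2)[OF \<omega>]])
      ultimately show "norm ((X \<omega> \<bullet> b) * (Y \<omega> \<bullet> b)) \<le> norm (K * norm (Y \<omega>))"
        unfolding real_norm_def abs_mult by simp
    qed
  qed
  have zero: "(LINT \<omega>|M. (X \<omega> \<bullet> b) * (Y \<omega> \<bullet> b)) = 0" if b: "b \<in> Basis" for b
  proof -
    have "(LINT \<omega>|M. (X \<omega> \<bullet> b) * (Y \<omega> \<bullet> b))
      = (LINT \<omega>|M. (X \<omega> \<bullet> b) * real_cond_exp M F (\<lambda>\<omega>. Y \<omega> \<bullet> b) \<omega>)"
      using int[OF b] X Y by (intro real_cond_exp_intg(2)[symmetric]) auto
    also have "\<dots> = 0"
      using mean[OF b] by (intro integral_eq_zero_AE) auto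
    finally show ?thesis .
  qed
  show "integrable M (\<lambda>\<omega>. X \<omega> \<bullet> Y \<omega>)"
    by (subst euclidean_inner) (intro Bochner_Integration.integrable_sum int)
  show "(LINT \<omega>|M. X \<omega> \<bullet> Y \<omega>) = 0"
    by (subst euclidean_inner) (simp add: Bochner_Integration.integral_sum int zero)
qed

lemma second_moment_le:
  assumes M: "prob_space M" and F: "subalgebra M F" and Y: "integrable M (\<lambda>\<omega>. (norm (Y \<omega>))\<^sup>2)"
    and var: "AE \<omega> in M. real_cond_exp M F (\<lambda>\<omega>. (norm (Y \<omega>))\<^sup>2) \<omega> / N \<le> S" and N: "0 < N"
  shows "(LINT \<omega>|M. (norm (Y \<omega>))\<^sup>2) \<le> N * S"
proof -
  interpret prob_space M by fact
  interpret finite_measure_subalgebra M F by unfold_locales fact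
  have "(LINT \<omega>|M. (norm (Y \<omega>))\<^sup>2) = (LINT \<omega>|M. real_cond_exp M F (\<lambda>\<omega>. (norm (Y \<omega>))\<^sup>2) \<omega>)"
    using real_cond_exp_int(2)[OF Y] by simp
  also have "\<dots> \<le> (LINT \<omega>|M. N * S)"
    using var N real_cond_exp_int(1)[OF Y]
    by (intro integral_mono_AE) (auto simp: pos_divide_le_eq mult.commute)
  finally show ?thesis by (simp add: prob_space)
qed

text \<open>All three cross terms of the expanded square integrate to zero: those with
  \<open>X\<close> by centering, the one between \<open>Y\<close> and \<open>Z\<close> by
  conditional uncorrelatedness. Only the variances remain.\<close>

lemma second_moment_perturbed_le:
  fixes X Y Z :: "'w \<Rightarrow> 'a::euclidean_space"
  assumes M: "prob_space M" and F: "subalgebra M F"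
    and X: "X \<in> borel_measurable F" "\<And>\<omega>. \<omega> \<in> space M \<Longrightarrow> norm (X \<omega>) \<le> K"
    and Y: "Y \<in> borel_measurable M" "integrable M (\<lambda>\<omega>. (norm (Y \<omega>))\<^sup>2)"
      "\<And>b. b \<in> Basis \<Longrightarrow> AE \<omega> in M. real_cond_exp M F (\<lambda>\<omega>. Y \<omega> \<bullet> b) \<omega> = 0"
    and Z: "Z \<in> borel_measurable M" "integrable M (\<lambda>\<omega>. (norm (Z \<omega>))\<^sup>2)"
      "\<And>b. b \<in> Basis \<Longrightarrow> AE \<omega> in M. real_cond_exp M F (\<lambda>\<omega>. Z \<omega> \<bullet> b) \<omega> = 0"
    and YZ: "AE \<omega> in M. real_cond_exp M F (\<lambda>\<omega>. Y \<omega> \<bullet> Z \<omega>) \<omega> = 0"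
    and Yvar: "AE \<omega> in M. real_cond_exp M F (\<lambda>\<omega>. (norm (Y \<omega>))\<^sup>2) \<omega> / N \<le> S1"
    and Zvar: "AE \<omega> in M. real_cond_exp M F (\<lambda>\<omega>. (norm (Z \<omega>))\<^sup>2) \<omega> / N \<le> S2"
    and N: "0 < N"
  shows "integrable M (\<lambda>\<omega>. (norm (X \<omega> + a *\<^sub>R Y \<omega> - b *\<^sub>R Z \<omega>))\<^sup>2)"
    and "(LINT \<omega>|M. (norm (X \<omega> + a *\<^sub>R Y \<omega> - b *\<^sub>R Z \<omega>))\<^sup>2)
      \<le> (LINT \<omega>|M. (norm (X \<omega>))\<^sup>2) + N * (a\<^sup>2 * S1 + b\<^sup>2 * S2)"
proof -
  interpret prob_space M by fact
  interpret finite_measure_subalgebra M F by unfold_locales fact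
  have XM[measurable]: "X \<in> borel_measurable M" using measurable_from_subalg[OF F X(1)] .
  note Y(1)[measurable] Z(1)[measurable]
  have "integrable M (\<lambda>\<omega>. (norm (X \<omega>))\<^sup>2)"
    using X(2) by (intro integrable_const_bound[of _ "K\<^sup>2"]) (auto intro!: power_mono)
  note XY = integral_inner_centered[OF M F X Y] and XZ = integral_inner_centered[OF M F X Z]
  have intYZ: "integrable M (\<lambda>\<omega>. Y \<omega> \<bullet> Z \<omega>)"
  proof (rule Bochner_Integration.integrable_bound)
    show "integrable M (\<lambda>\<omega>. (norm (Y \<omega>))\<^sup>2 + (norm (Z \<omega>))\<^sup>2)" using Y Z by simp
    have "\<bar>Y \<omega> \<bullet> Z \<omega>\<bar> \<le> (norm (Y \<omega>))\<^sup>2 + (norm (Z \<omega>))\<^sup>2" for \<omega>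
    proof -
      have "\<bar>Y \<omega> \<bullet> Z \<omega>\<bar> \<le> norm (Y \<omega>) * norm (Z \<omega>)" by (rule Cauchy_Schwarz_ineq2)
      also have "\<dots> \<le> 2 * norm (Y \<omega>) * norm (Z \<omega>)" by simp
      finally show ?thesis using sum_squares_bound[of "norm (Y \<omega>)" "norm (Z \<omega>)"] by linarith
    qed
    then show "AE \<omega> in M. norm (Y \<omega> \<bullet> Z \<omega>) \<le> norm ((norm (Y \<omega>))\<^sup>2 + (norm (Z \<omega>))\<^sup>2)" by simp
  qed measurable
  have "(LINT \<omega>|M. Y \<omega> \<bullet> Z \<omega>) = (LINT \<omega>|M. real_cond_exp M F (\<lambda>\<omega>. Y \<omega> \<bullet> Z \<omega>) \<omega>)"
    using real_cond_exp_int(2)[OF intYZ] by simp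
  also have "\<dots> = 0" using YZ by (rule integral_eq_zero_AE)
  finally have YZ0: "(LINT \<omega>|M. Y \<omega> \<bullet> Z \<omega>) = 0" .
  have eq: "(norm (X \<omega> + a *\<^sub>R Y \<omega> - b *\<^sub>R Z \<omega>))\<^sup>2 = (norm (X \<omega>))\<^sup>2 + a\<^sup>2 * (norm (Y \<omega>))\<^sup>2
    + b\<^sup>2 * (norm (Z \<omega>))\<^sup>2 + 2 * a * (X \<omega> \<bullet> Y \<omega>) - 2 * b * (X \<omega> \<bullet> Z \<omega>) - 2 * a * b * (Y \<omega> \<bullet> Z \<omega>)" for \<omega>
    unfolding power2_norm_eq_inner
    by (simp add: inner_add_left inner_add_right inner_diff_left inner_diff_right inner_commute
        power2_eq_square algebra_simps)
  note ints = \<open>integrable M (\<lambda>\<omega>. (norm (X \<omega>))\<^sup>2)\<close> Y(2) Z(2) XY(1) XZ(1) intYZ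
  show "integrable M (\<lambda>\<omega>. (norm (X \<omega> + a *\<^sub>R Y \<omega> - b *\<^sub>R Z \<omega>))\<^sup>2)"
    unfolding eq using ints by simp
  have "(LINT \<omega>|M. (norm (X \<omega> + a *\<^sub>R Y \<omega> - b *\<^sub>R Z \<omega>))\<^sup>2) = (LINT \<omega>|M. (norm (X \<omega>))\<^sup>2)
    + a\<^sup>2 * (LINT \<omega>|M. (norm (Y \<omega>))\<^sup>2) + b\<^sup>2 * (LINT \<omega>|M. (norm (Z \<omega>))\<^sup>2)"
    unfolding eq using ints by (simp add: XY(2) XZ(2) YZ0)
  also have "\<dots> \<le> (LINT \<omega>|M. (norm (X \<omega>))\<^sup>2) + a\<^sup>2 * (N * S1) + b\<^sup>2 * (N * S2)"
    using second_moment_le[OF M F Y(2) Yvar N] second_moment_le[OF M F Z(2) Zvar N]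
    by (intro add_mono mult_left_mono) auto
  finally show "(LINT \<omega>|M. (norm (X \<omega> + a *\<^sub>R Y \<omega> - b *\<^sub>R Z \<omega>))\<^sup>2)
      \<le> (LINT \<omega>|M. (norm (X \<omega>))\<^sup>2) + N * (a\<^sup>2 * S1 + b\<^sup>2 * S2)"
    by (simp add: algebra_simps)
qed

section \<open>The projected stochastic iteration\<close>

lemma Pprod_nonneg: "(\<And>j. a \<le> j \<Longrightarrow> mu * eta j \<le> 1) \<Longrightarrow> 0 \<le> Pprod mu eta a k"
  unfolding Pprod_def by (intro prod_nonneg) auto

text \<open>\<open>infdist wstar (frontier Wset)\<close> is the constant zeta. (C2) is written with
  cleared denominators, which keeps it meaningful when \<open>nabla_star = 0\<close>; the
  conditional means are stated per coordinate because \<open>real_cond_exp\<close> is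
  real-valued.\<close>

locale dsgd_network = network f mu L Lap wstar + prob_space M
  for f :: "'n::finite \<Rightarrow> real^'d::finite \<Rightarrow> real" and mu L :: real
    and Lap :: "real^'n^'n" and wstar :: "real^'d" and M :: "'w measure" +
  fixes Wset :: "(real^'d) set" and eta gam :: "nat \<Rightarrow> real" and F :: "nat \<Rightarrow> 'w measure"
    and kb :: nat and W0 :: "'w \<Rightarrow> real^'d^'n" and e1 e2 :: "nat \<Rightarrow> 'w \<Rightarrow> real^'d^'n"
    and S1 S2 :: real
  assumes W_closed: "closed Wset" and W_convex: "convex Wset" and W_bounded: "bounded Wset"
    and wstar_in: "wstar \<in> Wset"
    and eta_pos: "\<And>k. eta k > 0" and gam_pos: "\<And>k. gam k > 0"
    and F_sub: "\<And>k. subalgebra M (F k)"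
    and F_mono: "\<And>k. sets (F k) \<subseteq> sets (F (Suc k))"
    and W0_meas: "W0 \<in> borel_measurable (F kb)"
    and W0_in: "\<And>\<omega>. \<omega> \<in> space M \<Longrightarrow> W0 \<omega> \<in> stackset Wset"
    and e1_meas: "\<And>k. k \<ge> kb \<Longrightarrow> e1 k \<in> borel_measurable (F (Suc k))"
    and e2_meas: "\<And>k. k \<ge> kb \<Longrightarrow> e2 k \<in> borel_measurable (F (Suc k))"
    and e1_L2: "\<And>k. k \<ge> kb \<Longrightarrow> integrable M (\<lambda>\<omega>. (norm (e1 k \<omega>))\<^sup>2)"
    and e2_L2: "\<And>k. k \<ge> kb \<Longrightarrow> integrable M (\<lambda>\<omega>. (norm (e2 k \<omega>))\<^sup>2)"
    and e1_mean: "\<And>k b. k \<ge> kb \<Longrightarrow> b \<in> Basis \<Longrightarrow>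
                    AE \<omega> in M. real_cond_exp M (F k) (\<lambda>\<omega>. e1 k \<omega> \<bullet> b) \<omega> = 0"
    and e2_mean: "\<And>k b. k \<ge> kb \<Longrightarrow> b \<in> Basis \<Longrightarrow>
                    AE \<omega> in M. real_cond_exp M (F k) (\<lambda>\<omega>. e2 k \<omega> \<bullet> b) \<omega> = 0"
    and e12_uncorr: "\<And>k. k \<ge> kb \<Longrightarrow>
                    AE \<omega> in M. real_cond_exp M (F k) (\<lambda>\<omega>. e1 k \<omega> \<bullet> e2 k \<omega>) \<omega> = 0"
    and e1_var: "\<And>k. k \<ge> kb \<Longrightarrow>
                    AE \<omega> in M. real_cond_exp M (F k) (\<lambda>\<omega>. (norm (e1 k \<omega>))\<^sup>2) \<omega> / real CARD('n) \<le> S1"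
    and e2_var: "\<And>k. k \<ge> kb \<Longrightarrow>
                    AE \<omega> in M. real_cond_exp M (F k) (\<lambda>\<omega>. (norm (e2 k \<omega>))\<^sup>2) \<omega> / real CARD('n) \<le> S2"
    and C1: "\<And>k. k \<ge> kb \<Longrightarrow> eta k * (mu + L) + gam k * rho Lap CARD('n) \<le> 2"
    and C2: "\<And>k. k \<ge> kb \<Longrightarrow> eta k * (sqrt (real CARD('n)) * nabla_star * L)
                 \<le> infdist wstar (frontier Wset) * mu * rho Lap 2 * gam k"
    and C3: "\<And>k. k \<ge> kb \<Longrightarrow> gam k / eta k \<le> gam (Suc k) / eta (Suc k)"
begin

abbreviation "noisy \<equiv> dsgd Wset f Lap eta gam e1 e2 kb W0"
abbreviation "noiseless \<equiv> dsgd Wset f Lap eta gam (\<lambda>_ _. 0) (\<lambda>_ _. 0) kb W0"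
abbreviation "minim k \<equiv> Gmin Wset f Lap (gam k / eta k)"

definition descent :: "nat \<Rightarrow> real^'d^'n \<Rightarrow> real^'d^'n" where
  "descent k X = X - eta k *\<^sub>R pengrad (gam k / eta k) X"

lemma penalty_pos: "0 < gam k / eta k"
  using eta_pos gam_pos by simp

lemma descent_contraction:
  assumes k: "kb \<le> k"
  shows "norm (descent k X - descent k Y) \<le> (1 - mu * eta k) * norm (X - Y)"
    and step_size_le: "mu * eta k \<le> 1"
proof -
  have "eta k * (mu + L + gam k / eta k * rhoN) \<le> 2"
    using C1[OF k] eta_pos[of k] by (simp add: algebra_simps)
  note con = pengrad_step_contraction[OF less_imp_le[OF penalty_pos] less_imp_le[OF eta_pos] this]
  show "norm (descent k X - descent k Y) \<le> (1 - mu * eta k) * norm (X - Y)"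
    using con(1) by (simp only: descent_def mult.commute[of mu])
  show "mu * eta k \<le> 1" using con(2) by (simp only: mult.commute[of mu])
qed

lemma stack_facts:
  "convex (stackset Wset :: (real^'d^'n) set)" "closed (stackset Wset :: (real^'d^'n) set)"
  "(stackset Wset :: (real^'d^'n) set) \<noteq> {}"
proof -
  have "(\<chi> i. wstar) \<in> (stackset Wset :: (real^'d^'n) set)" using wstar_in by (simp add: stackset_def)
  then show "(stackset Wset :: (real^'d^'n) set) \<noteq> {}" by blast
qed (use W_convex W_closed stackset_convex stackset_closed in blast)+

lemma projN_in: "projN Wset V \<in> stackset Wset" for V :: "real^'d^'n"
  unfolding projN_def by (intro closest_point_in_set stack_facts)

lemma projN_nonexpansive: "norm (projN Wset V - projN Wset U) \<le> norm (V - U)" for V U :: "real^'d^'n"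
  using closest_point_lipschitz[OF stack_facts, of V U] by (simp add: projN_def dist_norm)

lemma projN_fixed: "V \<in> stackset Wset \<Longrightarrow> projN Wset V = V"
  unfolding projN_def by (rule closest_point_self)

lemma noisy_Suc: "noisy (Suc m) \<omega> = projN Wset (descent (kb + m) (noisy m \<omega>)
    + gam (kb + m) *\<^sub>R e1 (kb + m) \<omega> - eta (kb + m) *\<^sub>R e2 (kb + m) \<omega>)"
  by (simp add: descent_def grad_Gfun)

lemma noiseless_Suc: "noiseless (Suc m) \<omega> = projN Wset (descent (kb + m) (noiseless m \<omega>))"
  by (simp add: descent_def grad_Gfun)

lemma noisy_in: "\<omega> \<in> space M \<Longrightarrow> noisy m \<omega> \<in> stackset Wset"
  by (cases m) (simp_all add: W0_in projN_in)

lemma noiseless_in: "\<omega> \<in> space M \<Longrightarrow> noiseless m \<omega> \<in> stackset Wset"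
  by (cases m) (simp_all add: W0_in projN_in)

section \<open>Adaptedness of the iterates\<close>

lemma measurable_descent: "descent k \<in> borel_measurable borel"
  unfolding descent_def
  by (intro borel_measurable_continuous_onI continuous_intros continuous_on_subset[OF continuous_pengrad]) auto

lemma measurable_projN: "(projN Wset :: real^'d^'n \<Rightarrow> _) \<in> borel_measurable borel"
  unfolding projN_def[abs_def]
  by (intro borel_measurable_continuous_onI continuous_on_closest_point stack_facts)

lemma measurable_F_Suc: "g \<in> borel_measurable (F k) \<Longrightarrow> g \<in> borel_measurable (F (Suc k))"
  using measurable_mono[of borel borel "F k" "F (Suc k)"] F_mono[of k] F_sub
  by (auto simp: subalgebra_def)

lemma measurable_dsgd:
  assumes "\<And>k. k \<ge> kb \<Longrightarrow> d1 k \<in> borel_measurable (F (Suc k))"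
    and "\<And>k. k \<ge> kb \<Longrightarrow> d2 k \<in> borel_measurable (F (Suc k))"
  shows "dsgd Wset f Lap eta gam d1 d2 kb W0 m \<in> borel_measurable (F (kb + m))"
proof (induction m)
  case 0
  have "dsgd Wset f Lap eta gam d1 d2 kb W0 0 = W0" by (rule ext) simp
  then show ?case using W0_meas by simp
next
  case (Suc m)
  note [measurable] = measurable_F_Suc[OF Suc] measurable_descent measurable_projN
  have [measurable]: "d1 (kb + m) \<in> borel_measurable (F (Suc (kb + m)))"
    "d2 (kb + m) \<in> borel_measurable (F (Suc (kb + m)))" using assms by auto
  have "dsgd Wset f Lap eta gam d1 d2 kb W0 (Suc m) = (\<lambda>\<omega>. projN Wset
      (descent (kb + m) (dsgd Wset f Lap eta gam d1 d2 kb W0 m \<omega>)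
        + gam (kb + m) *\<^sub>R d1 (kb + m) \<omega> - eta (kb + m) *\<^sub>R d2 (kb + m) \<omega>))"
    by (rule ext) (simp add: descent_def grad_Gfun)
  moreover have "\<dots> \<in> borel_measurable (F (Suc (kb + m)))" by measurable
  ultimately show ?case by simp
qed

text \<open>Nonexpansiveness removes the projection before integration, so the noise enters linearly
  around \<open>X\<close>. This \<open>X\<close> is known at time \<open>k\<close> and bounded
  because the iterates stay in a bounded set, so the orthogonality argument applies; only then is
  the descent contraction squared.\<close>

lemma noise_error_step:
  "(LINT \<omega>|M. (norm (noisy (Suc m) \<omega> - noiseless (Suc m) \<omega>))\<^sup>2)
    \<le> (1 - mu * eta (kb + m))\<^sup>2 * (LINT \<omega>|M. (norm (noisy m \<omega> - noiseless m \<omega>))\<^sup>2)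
      + real CARD('n) * ((gam (kb + m))\<^sup>2 * S1 + (eta (kb + m))\<^sup>2 * S2)"
proof -
  define k where "k = kb + m"
  have k: "kb \<le> k" by (simp add: k_def)
  define X where "X \<omega> = descent k (noisy m \<omega>) - descent k (noiseless m \<omega>)" for \<omega>
  have mn: "noisy m \<in> borel_measurable (F k)" unfolding k_def
    by (rule measurable_dsgd) (use e1_meas e2_meas in auto)
  have ml: "noiseless m \<in> borel_measurable (F k)" unfolding k_def by (rule measurable_dsgd) auto
  have XF: "X \<in> borel_measurable (F k)"
  proof -
    note [measurable] = mn ml measurable_descent
    show ?thesis unfolding X_def by measurable
  qed
  have mM[measurable]: "noisy m \<in> borel_measurable M" "noiseless m \<in> borel_measurable M"
    using measurable_from_subalg[OF F_sub mn] measurable_from_subalg[OF F_sub ml] by auto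
  define K where "K = sqrt (real CARD('n)) * diameter Wset"
  have dK: "norm (noisy m \<omega> - noiseless m \<omega>) \<le> K" if "\<omega> \<in> space M" for \<omega>
    unfolding K_def using norm_diff_stackset_le[OF W_bounded noisy_in noiseless_in] that by blast
  have q: "0 \<le> 1 - mu * eta k" "1 - mu * eta k \<le> 1"
    using step_size_le[OF k] f_facts eta_pos[of k] by auto
  have Xle: "norm (X \<omega>) \<le> (1 - mu * eta k) * norm (noisy m \<omega> - noiseless m \<omega>)" for \<omega>
    unfolding X_def by (rule descent_contraction[OF k])
  have XK: "norm (X \<omega>) \<le> K" if "\<omega> \<in> space M" for \<omega>
  proof -
    have "norm (X \<omega>) \<le> 1 * norm (noisy m \<omega> - noiseless m \<omega>)"
      using Xle[of \<omega>] q by (intro order_trans[OF Xle] mult_right_mono) auto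
    then show ?thesis using dK[OF that] by simp
  qed
  have eM: "e1 k \<in> borel_measurable M" "e2 k \<in> borel_measurable M"
    using measurable_from_subalg[OF F_sub e1_meas[OF k]] measurable_from_subalg[OF F_sub e2_meas[OF k]] by auto
  note pert = second_moment_perturbed_le[OF prob_space_axioms F_sub XF XK eM(1) e1_L2[OF k] e1_mean[OF k]
      eM(2) e2_L2[OF k] e2_mean[OF k] e12_uncorr[OF k] e1_var[OF k] e2_var[OF k], of "gam k" "eta k"]
  have "(LINT \<omega>|M. (norm (noisy (Suc m) \<omega> - noiseless (Suc m) \<omega>))\<^sup>2)
    \<le> (LINT \<omega>|M. (norm (X \<omega> + gam k *\<^sub>R e1 k \<omega> - eta k *\<^sub>R e2 k \<omega>))\<^sup>2)"
  proof (rule integral_mono')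
    show "integrable M (\<lambda>\<omega>. (norm (X \<omega> + gam k *\<^sub>R e1 k \<omega> - eta k *\<^sub>R e2 k \<omega>))\<^sup>2)"
      by (rule pert(1)) auto
    fix \<omega>
    have "norm (noisy (Suc m) \<omega> - noiseless (Suc m) \<omega>)
      \<le> norm ((descent k (noisy m \<omega>) + gam k *\<^sub>R e1 k \<omega> - eta k *\<^sub>R e2 k \<omega>) - descent k (noiseless m \<omega>))"
      unfolding noisy_Suc noiseless_Suc k_def by (rule projN_nonexpansive)
    also have "\<dots> = norm (X \<omega> + gam k *\<^sub>R e1 k \<omega> - eta k *\<^sub>R e2 k \<omega>)"
      unfolding X_def by (rule arg_cong[of _ _ norm]) simp
    finally show "(norm (noisy (Suc m) \<omega> - noiseless (Suc m) \<omega>))\<^sup>2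
      \<le> (norm (X \<omega> + gam k *\<^sub>R e1 k \<omega> - eta k *\<^sub>R e2 k \<omega>))\<^sup>2" by (rule power_mono) simp
  qed simp
  also have "\<dots> \<le> (LINT \<omega>|M. (norm (X \<omega>))\<^sup>2) + real CARD('n) * ((gam k)\<^sup>2 * S1 + (eta k)\<^sup>2 * S2)"
    by (rule pert(2)) auto
  also have "(LINT \<omega>|M. (norm (X \<omega>))\<^sup>2) \<le> (LINT \<omega>|M. (1 - mu * eta k)\<^sup>2 * (norm (noisy m \<omega> - noiseless m \<omega>))\<^sup>2)"
  proof (rule integral_mono')
    have "integrable M (\<lambda>\<omega>. (norm (noisy m \<omega> - noiseless m \<omega>))\<^sup>2)"
    proof (rule integrable_const_bound)
      show "AE \<omega> in M. norm ((norm (noisy m \<omega> - noiseless m \<omega>))\<^sup>2) \<le> K\<^sup>2"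
        using dK by (intro AE_I2) (simp add: power_mono)
    qed measurable
    then show "integrable M (\<lambda>\<omega>. (1 - mu * eta k)\<^sup>2 * (norm (noisy m \<omega> - noiseless m \<omega>))\<^sup>2)" by simp
    fix \<omega>
    show "(norm (X \<omega>))\<^sup>2 \<le> (1 - mu * eta k)\<^sup>2 * (norm (noisy m \<omega> - noiseless m \<omega>))\<^sup>2"
      using power_mono[OF Xle[of \<omega>] norm_ge_zero, of 2] by (simp only: power_mult_distrib)
  qed simp
  finally show ?thesis by (simp add: k_def)
qed

lemma noise_error:
  assumes k: "kb \<le> k"
  shows "enorm M (\<lambda>\<omega>. noisy (k - kb) \<omega> - noiseless (k - kb) \<omega>) / sqrt (real CARD('n))
    \<le> sqrt (\<Sum>t\<in>{kb..<k}. (Pprod mu eta (Suc t) k)\<^sup>2 * ((gam t)\<^sup>2 * S1 + (eta t)\<^sup>2 * S2))"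
proof -
  define a where "a k = (LINT \<omega>|M. (norm (noisy (k - kb) \<omega> - noiseless (k - kb) \<omega>))\<^sup>2)" for k
  define s where "s t = (gam t)\<^sup>2 * S1 + (eta t)\<^sup>2 * S2" for t
  have "a k \<le> a kb * (\<Prod>j\<in>{kb..<k}. (1 - mu * eta j)\<^sup>2)
    + (\<Sum>t\<in>{kb..<k}. (\<Prod>j\<in>{Suc t..<k}. (1 - mu * eta j)\<^sup>2) * (real CARD('n) * s t))"
  proof (rule linear_recursion_bound)
    fix k assume "kb \<le> k"
    then show "a (Suc k) \<le> (1 - mu * eta k)\<^sup>2 * a k + real CARD('n) * s k"
      using noise_error_step[of "k - kb"] by (simp only: a_def s_def Suc_diff_le le_add_diff_inverse)
  qed (use k in auto)
  \<comment> \<open>Both trajectories start at \<open>W0\<close>, so the homogeneous term of the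
    recursion disappears.\<close>
  moreover have "a kb = 0" by (simp add: a_def)
  ultimately have "a k \<le> real CARD('n) * (\<Sum>t\<in>{kb..<k}. (Pprod mu eta (Suc t) k)\<^sup>2 * s t)"
    by (simp add: Pprod_def prod_power_distrib sum_distrib_left mult_ac)
  then have "sqrt (a k) / sqrt (real CARD('n)) \<le> sqrt (\<Sum>t\<in>{kb..<k}. (Pprod mu eta (Suc t) k)\<^sup>2 * s t)"
    unfolding real_sqrt_divide[symmetric] by (intro real_sqrt_le_mono) (simp add: field_simps)
  then show ?thesis by (simp only: enorm_def a_def s_def)
qed

lemma minimizer:
  assumes k: "kb \<le> k"
  shows minimizer_stationary: "pengrad (gam k / eta k) (minim k) = 0"
    and minimizer_in: "minim k \<in> stackset Wset"
proof -
  obtain U where U: "pengrad (gam k / eta k) U = 0"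
    using pengrad_zero_exists[OF less_imp_le[OF penalty_pos]] by blast
  have pos: "0 < mu * rho Lap 2 * gam k" using f_facts rho2 gam_pos by simp
  have "norm (U - Wstar) \<le> sqrt (real CARD('n)) * (nabla_star * L / (mu * rho Lap 2) * (1 / (gam k / eta k)))"
    by (rule consensus_error[OF penalty_pos U])
  also have "\<dots> = eta k * (sqrt (real CARD('n)) * nabla_star * L) / (mu * rho Lap 2 * gam k)"
    by (simp add: field_simps)
  also have "\<dots> \<le> infdist wstar (frontier Wset)"
    using C2[OF k] pos by (simp add: pos_divide_le_eq mult_ac)
  finally have d: "norm (U - Wstar) \<le> infdist wstar (frontier Wset)" .
  have "U \<in> stackset Wset"
    unfolding stackset_def
  proof safe
    fix i
    \<comment> \<open>The bound for the whole stacked vector is used for each block; this is why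
      \<open>sqrt N\<close> occurs in (C2).\<close>
    have "norm (U $ i - wstar) \<le> norm (U - Wstar)"
      using Finite_Cartesian_Product.norm_nth_le[of "U - Wstar" i] by (simp add: Wstar_def)
    then show "U $ i \<in> Wset"
      using d by (intro mem_if_norm_le_infdist_frontier[OF W_closed wstar_in]) simp
  qed
  moreover from this have "minim k = U" by (intro Gmin_eqI U less_imp_le[OF penalty_pos])
  ultimately show "pengrad (gam k / eta k) (minim k) = 0" "minim k \<in> stackset Wset"
    using U by auto
qed

text \<open>A stationary point inside the set is fixed by the projected step, so the step contracts
  towards \<open>minim k\<close>; the triangle inequality then changes the target to
  \<open>minim (Suc k)\<close> at the cost of the drift, for which (C3) orders the
  penalties.\<close>

lemma noiseless_tracking_step:
  assumes k: "kb \<le> k"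
  shows "norm (noiseless (Suc k - kb) \<omega> - minim (Suc k))
    \<le> (1 - mu * eta k) * norm (noiseless (k - kb) \<omega> - minim k)
      + sqrt (real CARD('n)) * (nabla_star * L / (mu * rho Lap 2)
        * ((1 + L\<^sup>2 / (mu * rho Lap 2) * (eta k / gam k)) * (eta k / gam k - eta (Suc k) / gam (Suc k))))"
proof -
  have fixed: "projN Wset (descent k (minim k)) = minim k"
    using minimizer[OF k] by (simp add: descent_def projN_fixed)
  have "noiseless (Suc k - kb) \<omega> = projN Wset (descent k (noiseless (k - kb) \<omega>))"
    using noiseless_Suc[of "k - kb" \<omega>] k by (simp only: Suc_diff_le le_add_diff_inverse)
  then have "norm (noiseless (Suc k - kb) \<omega> - minim k) \<le> norm (descent k (noiseless (k - kb) \<omega>) - descent k (minim k))"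
    using projN_nonexpansive[of "descent k (noiseless (k - kb) \<omega>)" "descent k (minim k)"] by (simp only: fixed)
  also have "\<dots> \<le> (1 - mu * eta k) * norm (noiseless (k - kb) \<omega> - minim k)"
    by (rule descent_contraction[OF k])
  finally have 1: "norm (noiseless (Suc k - kb) \<omega> - minim k) \<le> (1 - mu * eta k) * norm (noiseless (k - kb) \<omega> - minim k)" .
  have 2: "norm (minim k - minim (Suc k)) \<le> sqrt (real CARD('n)) * (nabla_star * L / (mu * rho Lap 2)
        * ((1 + L\<^sup>2 / (mu * rho Lap 2) * (eta k / gam k)) * (eta k / gam k - eta (Suc k) / gam (Suc k))))"
    using minimizer_drift[OF penalty_pos C3[OF k] minimizer_stationary[OF k] minimizer_stationary[of "Suc k"]] k
    by simp
  have "norm (noiseless (Suc k - kb) \<omega> - minim (Suc k))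
    \<le> norm (noiseless (Suc k - kb) \<omega> - minim k) + norm (minim k - minim (Suc k))"
    using norm_triangle_ineq[of "noiseless (Suc k - kb) \<omega> - minim k" "minim k - minim (Suc k)"] by simp
  then show ?thesis using 1 2 by linarith
qed

text \<open>The recursion runs separately at each sample point, and the uniform bound is then
  squared and integrated. \<open>Pprod mu eta kb k\<close> is the product P with index
  \<open>kb - 1\<close>: \<open>Pprod\<close> takes the first factor's index, so
  \<open>kb = 0\<close> needs no predecessor.\<close>

lemma noiseless_tracking:
  assumes k: "kb \<le> k"
  shows "enorm M (\<lambda>\<omega>. noiseless (k - kb) \<omega> - minim k) / sqrt (real CARD('n))
    \<le> diameter Wset * Pprod mu eta kb k + nabla_star * L / (mu * rho Lap 2)
      * (\<Sum>t\<in>{kb..<k}. Pprod mu eta (Suc t) k * (1 + L\<^sup>2 / (mu * rho Lap 2) * (eta t / gam t))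
          * (eta t / gam t - eta (Suc t) / gam (Suc t)))" (is "_ \<le> ?B")
proof -
  define C where "C = nabla_star * L / (mu * rho Lap 2)"
  define s where "s t = (1 + L\<^sup>2 / (mu * rho Lap 2) * (eta t / gam t)) * (eta t / gam t - eta (Suc t) / gam (Suc t))" for t
  have B: "?B = diameter Wset * Pprod mu eta kb k + C * (\<Sum>t\<in>{kb..<k}. Pprod mu eta (Suc t) k * s t)"
    by (simp only: C_def s_def mult.assoc)
  have le: "norm (noiseless (k - kb) \<omega> - minim k) \<le> sqrt (real CARD('n)) * ?B" if \<omega>: "\<omega> \<in> space M" for \<omega>
  proof -
    define a where "a k = norm (noiseless (k - kb) \<omega> - minim k)" for k
    have "a k \<le> a kb * (\<Prod>j\<in>{kb..<k}. 1 - mu * eta j)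
      + (\<Sum>t\<in>{kb..<k}. (\<Prod>j\<in>{Suc t..<k}. 1 - mu * eta j) * (sqrt (real CARD('n)) * (C * s t)))"
    proof (rule linear_recursion_bound)
      fix k assume "kb \<le> k"
      from noiseless_tracking_step[OF this, of \<omega>]
      show "a (Suc k) \<le> (1 - mu * eta k) * a k + sqrt (real CARD('n)) * (C * s k)"
        by (simp only: a_def s_def C_def)
    qed (use k step_size_le in auto)
    also have "\<dots> \<le> (sqrt (real CARD('n)) * diameter Wset) * Pprod mu eta kb k
      + (\<Sum>t\<in>{kb..<k}. Pprod mu eta (Suc t) k * (sqrt (real CARD('n)) * (C * s t)))"
      unfolding Pprod_def[symmetric]
    proof (intro add_right_mono mult_right_mono)
      show "a kb \<le> sqrt (real CARD('n)) * diameter Wset"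
        unfolding a_def by (intro norm_diff_stackset_le W_bounded noiseless_in \<omega> minimizer_in) simp
      show "0 \<le> Pprod mu eta kb k" using step_size_le by (intro Pprod_nonneg)
    qed
    also have "\<dots> = sqrt (real CARD('n)) * ?B"
      unfolding B by (simp add: algebra_simps sum_distrib_left)
    finally show ?thesis by (simp only: a_def)
  qed
  \<comment> \<open>Nonnegativity of the bound, required by \<open>enorm_le\<close>, is read off
    from the pointwise estimate at an arbitrary sample point.\<close>
  obtain \<omega> where "\<omega> \<in> space M" using not_empty by blast
  have "0 \<le> sqrt (real CARD('n)) * ?B" by (rule order_trans[OF norm_ge_zero le[OF \<open>\<omega> \<in> space M\<close>]])
  then have "enorm M (\<lambda>\<omega>. noiseless (k - kb) \<omega> - minim k) \<le> sqrt (real CARD('n)) * ?B"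
    using le by (rule enorm_le[OF prob_space_axioms])
  then show ?thesis by (simp only: pos_divide_le_eq real_sqrt_gt_0_iff of_nat_0_less_iff zero_less_card_finite mult.commute)
qed

lemma minimizer_consensus_error:
  assumes k: "kb \<le> k"
  shows "norm (minim k - (\<chi> i. wstar)) / sqrt (real CARD('n)) \<le> nabla_star * L / (mu * rho Lap 2) * (eta k / gam k)"
  using consensus_error[OF penalty_pos minimizer_stationary[OF k]]
  by (simp add: Wstar_def pos_divide_le_eq mult_ac)

end

theorem theorem1:
  fixes f :: "'n::finite \<Rightarrow> real^'d::finite \<Rightarrow> real"
    and mu Lsm :: real
    and wstar :: "real^'d"
    and Wset :: "(real^'d) set"
    and Lap :: "real^'n^'n"
    and eta gam :: "nat \<Rightarrow> real"
    and M :: "'w measure" and F :: "nat \<Rightarrow> 'w measure"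
    and kb :: nat
    and W0 :: "'w \<Rightarrow> real^'d^'n"
    and e1 e2 :: "nat \<Rightarrow> 'w \<Rightarrow> real^'d^'n"
    and S1 S2 :: real
  assumes N2: "CARD('n) \<ge> 2"
    and mu_pos: "0 < mu" and mu_le_L: "mu \<le> Lsm"
    and f_diff: "\<And>i x. f i differentiable (at x)"
    and f_smooth: "\<And>i x y. norm (grad (f i) x - grad (f i) y) \<le> Lsm * norm (x - y)"
    and f_sconvex: "\<And>i. convex_on UNIV (\<lambda>x. f i x - mu / 2 * (norm x)\<^sup>2)"
    and wstar_min: "\<And>w. (\<Sum>i\<in>UNIV. f i wstar) / real CARD('n) \<le> (\<Sum>i\<in>UNIV. f i w) / real CARD('n)"
    and W_closed: "closed Wset" and W_convex: "convex Wset" and W_bounded: "bounded Wset"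
    and W_ne: "Wset \<noteq> {}" and wstar_int: "wstar \<in> interior Wset"
    and Lap_sym: "transpose Lap = Lap"
    and Lap_offdiag: "\<And>i j. i \<noteq> j \<Longrightarrow> Lap$i$j \<le> 0"
    and Lap_rows: "Lap *v (\<chi> i. 1) = 0"
    and rho2_pos: "rho Lap 2 > 0"
    and eta_pos: "\<And>k. eta k > 0" and gam_pos: "\<And>k. gam k > 0"
    and M_prob: "prob_space M"
    and F_sub: "\<And>k. subalgebra M (F k)"
    and F_mono: "\<And>k. sets (F k) \<subseteq> sets (F (Suc k))"
    and W0_meas: "W0 \<in> borel_measurable (F kb)"
    and W0_in: "\<And>\<omega>. \<omega> \<in> space M \<Longrightarrow> W0 \<omega> \<in> stackset Wset"
    and e1_meas: "\<And>k. k \<ge> kb \<Longrightarrow> e1 k \<in> borel_measurable (F (Suc k))"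
    and e2_meas: "\<And>k. k \<ge> kb \<Longrightarrow> e2 k \<in> borel_measurable (F (Suc k))"
    and e1_L2: "\<And>k. k \<ge> kb \<Longrightarrow> integrable M (\<lambda>\<omega>. (norm (e1 k \<omega>))\<^sup>2)"
    and e2_L2: "\<And>k. k \<ge> kb \<Longrightarrow> integrable M (\<lambda>\<omega>. (norm (e2 k \<omega>))\<^sup>2)"
    and e1_mean: "\<And>k b. k \<ge> kb \<Longrightarrow> b \<in> Basis \<Longrightarrow>
                    AE \<omega> in M. real_cond_exp M (F k) (\<lambda>\<omega>. e1 k \<omega> \<bullet> b) \<omega> = 0"
    and e2_mean: "\<And>k b. k \<ge> kb \<Longrightarrow> b \<in> Basis \<Longrightarrow>
                    AE \<omega> in M. real_cond_exp M (F k) (\<lambda>\<omega>. e2 k \<omega> \<bullet> b) \<omega> = 0"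
    and e12_uncorr: "\<And>k. k \<ge> kb \<Longrightarrow>
                    AE \<omega> in M. real_cond_exp M (F k) (\<lambda>\<omega>. e1 k \<omega> \<bullet> e2 k \<omega>) \<omega> = 0"
    and e1_var: "\<And>k. k \<ge> kb \<Longrightarrow>
                    AE \<omega> in M. real_cond_exp M (F k) (\<lambda>\<omega>. (norm (e1 k \<omega>))\<^sup>2) \<omega> / real CARD('n) \<le> S1"
    and e2_var: "\<And>k. k \<ge> kb \<Longrightarrow>
                    AE \<omega> in M. real_cond_exp M (F k) (\<lambda>\<omega>. (norm (e2 k \<omega>))\<^sup>2) \<omega> / real CARD('n) \<le> S2"
    and S1_nn: "S1 \<ge> 0" and S2_nn: "S2 \<ge> 0"
    and C1: "\<And>k. k \<ge> kb \<Longrightarrow> eta k * (mu + Lsm) + gam k * rho Lap CARD('n) \<le> 2"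
    and C2: "\<And>k. k \<ge> kb \<Longrightarrow>
               eta k * (sqrt (real CARD('n)) * (MAX i. norm (grad (f i) wstar)) * Lsm)
                 \<le> infdist wstar (frontier Wset) * mu * rho Lap 2 * gam k"
    and C3: "\<And>k. k \<ge> kb \<Longrightarrow> gam k / eta k \<le> gam (Suc k) / eta (Suc k)"
  shows "\<forall>k\<ge>kb.
     enorm M (\<lambda>\<omega>. dsgd Wset f Lap eta gam e1 e2 kb W0 (k - kb) \<omega>
                    - dsgd Wset f Lap eta gam (\<lambda>_ _. 0) (\<lambda>_ _. 0) kb W0 (k - kb) \<omega>) / sqrt (real CARD('n))
       \<le> sqrt (\<Sum>t\<in>{kb..<k}. (Pprod mu eta (Suc t) k)\<^sup>2 * ((gam t)\<^sup>2 * S1 + (eta t)\<^sup>2 * S2))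
   \<and> enorm M (\<lambda>\<omega>. dsgd Wset f Lap eta gam (\<lambda>_ _. 0) (\<lambda>_ _. 0) kb W0 (k - kb) \<omega>
                    - Gmin Wset f Lap (gam k / eta k)) / sqrt (real CARD('n))
       \<le> diameter Wset * Pprod mu eta kb k
          + (MAX i. norm (grad (f i) wstar)) * Lsm / (mu * rho Lap 2)
            * (\<Sum>t\<in>{kb..<k}. Pprod mu eta (Suc t) k
                 * (1 + Lsm\<^sup>2 / (mu * rho Lap 2) * (eta t / gam t))
                 * (eta t / gam t - eta (Suc t) / gam (Suc t)))
   \<and> norm (Gmin Wset f Lap (gam k / eta k) - (\<chi> i. wstar)) / sqrt (real CARD('n))
       \<le> (MAX i. norm (grad (f i) wstar)) * Lsm / (mu * rho Lap 2) * (eta k / gam k)"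
proof -
  have ssc: "smooth_strongly_convex (f i) mu Lsm" for i
    by unfold_locales (use mu_pos mu_le_L f_diff f_smooth f_sconvex in auto)
  have "((\<lambda>w. \<Sum>i\<in>UNIV. f i w) has_derivative (\<lambda>h. \<Sum>i\<in>UNIV. h \<bullet> grad (f i) wstar)) (at wstar)"
    using smooth_strongly_convex.GDERIV[OF ssc] by (intro has_derivative_sum) (simp add: gderiv_def)
  moreover have "\<forall>w\<in>UNIV. (\<Sum>i\<in>UNIV. f i wstar) \<le> (\<Sum>i\<in>UNIV. f i w)"
    using wstar_min by (simp add: divide_le_cancel)
  ultimately have "(\<lambda>h. \<Sum>i\<in>UNIV. h \<bullet> grad (f i) wstar) = (\<lambda>h. 0)"
    by (intro differential_zero_maxmin[of wstar UNIV "\<lambda>w. \<Sum>i\<in>UNIV. f i w"]) auto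
  \<comment> \<open>The vanishing differential is tested in the direction of the gradient sum
    itself.\<close>
  then have "(\<Sum>i\<in>UNIV. grad (f i) wstar) \<bullet> (\<Sum>i\<in>UNIV. grad (f i) wstar) = 0"
    by (metis (no_types) inner_sum_right)
  then have stat: "(\<Sum>i\<in>UNIV. grad (f i) wstar) = 0" by simp
  interpret net: network f mu Lsm Lap wstar
    by (rule network.intro[OF ssc Lap_sym Lap_offdiag Lap_rows N2 rho2_pos stat])
  interpret prob_space M by (rule M_prob)
  have "wstar \<in> Wset" using wstar_int interior_subset by blast
  note asms = W_closed W_convex W_bounded this eta_pos gam_pos F_sub F_mono W0_meas W0_in e1_meas e2_meas
    e1_L2 e2_L2 e1_mean e2_mean e12_uncorr e1_var e2_var C1 C2[folded net.nabla_star_def] C3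
  interpret dsgd_network f mu Lsm Lap wstar M Wset eta gam F kb W0 e1 e2 S1 S2
    by (intro dsgd_network.intro dsgd_network_axioms.intro net.network_axioms prob_space_axioms; (rule asms; assumption?))
  show ?thesis
    using noise_error noiseless_tracking minimizer_consensus_error
    unfolding net.nabla_star_def by blast
qed

end
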